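(* Let $\mathcal{C}$ be a reversal-closed super-$\mathrm{AFL}$. Let $M$ be a weakly compressible monoid (given by a finite presentation that is weakly compressible), and let $L(M)$ be its left monoid. Then $M$ has word problem in $\mathcal{C}$ if and only if $L(M)$ has word problem in $\mathcal{C}$.
   Context: Words and languages. $A^\ast$ is the free monoid on a finite alphabet $A$, with identity the empty word $\varepsilon$; $A^+ = A^\ast\setminus\{\varepsilon\}$; $u \equiv v$ means equality of words; $w^{\mathrm{rev}}$ is the reverse of the word $w$, and $L^{\mathrm{rev}}=\{w^{\mathrm{rev}} : w\in L\}$. A class $\mathcal{C}$ of languages is reversal-closed if $L\in\mathcal{C}$ implies $L^{\mathrm{rev}}\in\mathcal{C}$. A word is self-overlap free if it is empty, or if no proper non-empty prefix of it is also a proper non-empty suffix of it. Word problem. Let $N$ be a monoid generated by a finite set $B$, i.e. with a surjective homomorphism $\pi\colon B^\ast\to N$; write $u=_N v$ for $\pi(u)=\pi(v)$. The word problem of $N$ with respect to $B$ is the language $\mathrm{WP}^N_B=\{u\# v^{\mathrm{rev}} : u,v\in B^\ast,\ u=_N v\}$, where $\#\notin B$ is a fixed symbol. $N$ has word problem in $\mathcal{C}$ if $\mathrm{WP}^N_B\in\mathcal{C}$; if $\mathcal{C}$ is closed under inverse homomorphism this does not depend on the finite generating set $B$. Super-$\mathrm{AFL}$s. An $\mathrm{AFL}$ is a class of languages closed under homomorphism, inverse homomorphism, intersection with regular languages, union, concatenation, and Kleene star. A rewriting system on $A$ is a subset $\mathcal{R}\subseteq A^\ast\times A^\ast$; write $x\ell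 y\to_{\mathcal{R}} xry$ for $(\ell,r)\in\mathcal{R}$, $x,y\in A^\ast$, and let $\to^\ast_{\mathcal{R}}$ be the reflexive transitive closure. For $X\subseteq A^\ast$ put $\langle X\rangle_{\mathcal{R}}=\{w\in A^\ast : w\to^\ast_{\mathcal{R}} x\text{ for some }x\in X\}$. $\mathcal{R}$ is monadic if $(u,v)\in\mathcal{R}$ implies $|u|\ge|v|$ and $v\in A\cup\{\varepsilon\}$; a monadic $\mathcal{R}$ is a monadic $\mathcal{C}$-rewriting system if $\{u : (u,a)\in\mathcal{R}\}\in\mathcal{C}$ for every $a\in A\cup\{\varepsilon\}$. $\mathcal{C}$ has the monadic ancestor property if for every finite alphabet $A$, every monadic $\mathcal{C}$-rewriting system $\mathcal{R}$ on $A$ and every $L\subseteq A^\ast$ with $L\in\mathcal{C}$, one has $\langle L\rangle_{\mathcal{R}}\in\mathcal{C}$. A super-$\mathrm{AFL}$ is an $\mathrm{AFL}$ with the monadic ancestor property. Weak compression. Let $M$ be the monoid given by the finite presentation $\mathrm{Mon}\langle A\mid u_i=v_i\ (1\le i\le p)\rangle$. A pair $(u,v)$ is sealed by $w\in A^+$ if $u,v\in wA^\ast\cap A^\ast w$. $M$ is weakly compressible (with respect to $\alpha$) if there is a self-overlap free word $\alpha\in A^+$ such that every pair $(u_i,v_i)$ is sealed by $\alpha$. Let $\Sigma_\ast=\alpha(A^\ast\setminus A^\ast\alpha A^\ast)$; this is a suffix code. Let $\Gamma_\ast=\{\gamma_w : w\in\Sigma_\ast\}$ be a set of symbols in bijection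 with $\Sigma_\ast$, and let $\varphi\colon\Sigma_\ast^\ast\to\Gamma_\ast^\ast$ be the isomorphism of free monoids with $w\mapsto\gamma_w$ for $w\in\Sigma_\ast$. Each $u_i,v_i$ lies in $\Sigma_\ast^\ast\alpha$; factor uniquely $u_i\equiv u_{i,1}\cdots u_{i,m_i}\alpha$ and $v_i\equiv v_{i,1}\cdots v_{i,n_i}\alpha$ with all $u_{i,j},v_{i,k}\in\Sigma_\ast$. Let $\Sigma\subseteq\Sigma_\ast$ be the finite set of all the words $u_{i,j},v_{i,k}$ and $\Gamma=\varphi(\Sigma)$. The extended left monoid is $L_\ast(M)=\mathrm{Mon}\langle\Gamma_\ast\mid\varphi(u_{i,1}\cdots u_{i,m_i})=\varphi(v_{i,1}\cdots v_{i,n_i})\ (1\le i\le p)\rangle$, and the left monoid $L(M)$ is the submonoid of $L_\ast(M)$ generated by $\Gamma$; it has the finite presentation with generating set $\Gamma$ and the same defining relations. *)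

theory Defs
  imports "HOL-Algebra.Group" "HOL-Library.Sublist"
begin

text \<open>
  Formal languages are sets of words over finite subsets of a fixed countably infinite supply of
  symbols, here \<^typ>\<open>nat\<close>. A class of languages is thus a \<^typ>\<open>nat list set set\<close>.
\<close>

definition self_overlap_free :: "'a list \<Rightarrow> bool" where
  "self_overlap_free w \<longleftrightarrow>
     w = [] \<or> \<not> (\<exists>p. p \<noteq> [] \<and> strict_prefix p w \<and> strict_suffix p w)"

definition reversal_closed :: "nat list set set \<Rightarrow> bool" where
  "reversal_closed C \<longleftrightarrow> (\<forall>L\<in>C. rev ` L \<in> C)"

text \<open>Accepted by a complete deterministic finite automaton.\<close>

definition regular :: "nat list set \<Rightarrow> bool" where
  "regular L \<longleftrightarrow>
     (\<exists>(A :: nat set) (Q :: nat set) \<delta> q\<^sub>0 F.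
        finite A \<and> finite Q \<and> q\<^sub>0 \<in> Q \<and> F \<subseteq> Q \<and> (\<forall>q\<in>Q. \<forall>a\<in>A. \<delta> q a \<in> Q) \<and>
        L = {w \<in> lists A. foldl \<delta> q\<^sub>0 w \<in> F})"

text \<open>
  A homomorphism of free monoids is given by a map \<open>h\<close> from letters to words, extended to words
  by \<open>hom_ext h\<close>. An inverse image depends on the (finite) alphabet of the domain, hence
  the \<open>A\<close> in the clause for inverse homomorphisms.
\<close>

definition hom_ext :: "('a \<Rightarrow> 'b list) \<Rightarrow> 'a list \<Rightarrow> 'b list" where
  "hom_ext h w = concat (map h w)"

definition AFL :: "nat list set set \<Rightarrow> bool" where
  "AFL C \<longleftrightarrow>
     (\<forall>L\<in>C. \<exists>A. finite A \<and> L \<subseteq> lists A) \<and>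
     (\<forall>L\<in>C. \<forall>h. hom_ext h ` L \<in> C) \<and>
     (\<forall>L\<in>C. \<forall>h A. finite A \<longrightarrow> {w \<in> lists A. hom_ext h w \<in> L} \<in> C) \<and>
     (\<forall>L\<in>C. \<forall>K. regular K \<longrightarrow> L \<inter> K \<in> C) \<and>
     (\<forall>L\<in>C. \<forall>K\<in>C. L \<union> K \<in> C) \<and>
     (\<forall>L\<in>C. \<forall>K\<in>C. {u @ v | u v. u \<in> L \<and> v \<in> K} \<in> C) \<and>
     (\<forall>L\<in>C. concat ` lists L \<in> C)"

definition rewrite_step :: "'a set \<Rightarrow> ('a list \<times> 'a list) set \<Rightarrow> ('a list \<times> 'a list) set" where
  "rewrite_step A R =
     {(x @ l @ y, x @ r @ y) | x y l r. (l, r) \<in> R \<and> x \<in> lists A \<and> y \<in> lists A}"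

definition ancestors :: "'a set \<Rightarrow> ('a list \<times> 'a list) set \<Rightarrow> 'a list set \<Rightarrow> 'a list set" where
  "ancestors A R X = {w \<in> lists A. \<exists>x\<in>X. (w, x) \<in> (rewrite_step A R)\<^sup>*}"

definition letters_or_empty :: "'a set \<Rightarrow> 'a list set" where
  "letters_or_empty A = insert [] ((\<lambda>a. [a]) ` A)"

definition monadic :: "'a set \<Rightarrow> ('a list \<times> 'a list) set \<Rightarrow> bool" where
  "monadic A R \<longleftrightarrow>
     R \<subseteq> lists A \<times> lists A \<and>
     (\<forall>(u, v)\<in>R. length u \<ge> length v \<and> v \<in> letters_or_empty A)"

definition monadic_system ::
    "nat list set set \<Rightarrow> nat set \<Rightarrow> (nat list \<times> nat list) set \<Rightarrow> bool" where
  "monadic_system C A R \<longleftrightarrow>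
     monadic A R \<and> (\<forall>a\<in>letters_or_empty A. {u. (u, a) \<in> R} \<in> C)"

definition monadic_ancestor_property :: "nat list set set \<Rightarrow> bool" where
  "monadic_ancestor_property C \<longleftrightarrow>
     (\<forall>A R L. finite A \<and> monadic_system C A R \<and> L \<subseteq> lists A \<and> L \<in> C \<longrightarrow> ancestors A R L \<in> C)"

definition super_AFL :: "nat list set set \<Rightarrow> bool" where
  "super_AFL C \<longleftrightarrow> AFL C \<and> monadic_ancestor_property C"

definition free_monoid :: "'a set \<Rightarrow> 'a list monoid" where
  "free_monoid A = \<lparr>carrier = lists A, mult = (@), one = []\<rparr>"

text \<open>
  The set \<open>B\<close> of symbols generates \<open>N\<close> via \<open>\<pi>\<close>. The unit is mentioned separately because
  \<^const>\<open>hom\<close> only refers to multiplication.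
\<close>

definition generates_via :: "('n, 'x) monoid_scheme \<Rightarrow> 'b set \<Rightarrow> ('b list \<Rightarrow> 'n) \<Rightarrow> bool" where
  "generates_via N B \<pi> \<longleftrightarrow>
     \<pi> \<in> hom (free_monoid B) N \<and> \<pi> [] = \<one>\<^bsub>N\<^esub> \<and> \<pi> ` lists B = carrier N"

definition word_problem :: "'b set \<Rightarrow> ('b list \<Rightarrow> 'n) \<Rightarrow> 'b \<Rightarrow> 'b list set" where
  "word_problem B \<pi> h = {u @ [h] @ rev v | u v. u \<in> lists B \<and> v \<in> lists B \<and> \<pi> u = \<pi> v}"

text \<open>
  If \<open>C\<close> is closed under inverse homomorphism, then membership of the word problem in \<open>C\<close> does
  not depend on the finite generating set or on the separator \<open>h\<close>; here some choice is required
  to work.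
\<close>

definition has_word_problem_in ::
    "('n, 'x) monoid_scheme \<Rightarrow> nat list set set \<Rightarrow> bool" where
  "has_word_problem_in N C \<longleftrightarrow>
     (\<exists>B \<pi> h. finite B \<and> h \<notin> B \<and> generates_via N B \<pi> \<and> word_problem B \<pi> h \<in> C)"

definition pres_cong :: "'a set \<Rightarrow> ('a list \<times> 'a list) set \<Rightarrow> ('a list \<times> 'a list) set" where
  "pres_cong A R = (rewrite_step A R \<union> (rewrite_step A R)\<inverse>)\<^sup>* \<inter> lists A \<times> lists A"

text \<open>The monoid \<open>Mon\<langle>A | u = v ((u, v) \<in> R)\<rangle>\<close>; \<open>A\<close> and \<open>R\<close> need not be finite.\<close>

definition presented_monoid :: "'a set \<Rightarrow> ('a list \<times> 'a list) set \<Rightarrow> 'a list set monoid" where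
  "presented_monoid A R =
     \<lparr>carrier = lists A // pres_cong A R,
      mult = (\<lambda>X Y. \<Union>x\<in>X. \<Union>y\<in>Y. pres_cong A R `` {x @ y}),
      one = pres_cong A R `` {[]}\<rparr>"

definition submonoid_generated :: "('n, 'x) monoid_scheme \<Rightarrow> 'n set \<Rightarrow> ('n, 'x) monoid_scheme" where
  "submonoid_generated N X = N\<lparr>carrier := \<Inter>{H. submonoid H N \<and> X \<subseteq> H}\<rparr>"

definition sealed :: "'a set \<Rightarrow> 'a list \<Rightarrow> 'a list \<times> 'a list \<Rightarrow> bool" where
  "sealed A w = (\<lambda>(u, v).
     {u, v} \<subseteq> {w @ x | x. x \<in> lists A} \<inter> {x @ w | x. x \<in> lists A})"

definition weakly_compressible ::
    "'a set \<Rightarrow> ('a list \<times> 'a list) set \<Rightarrow> 'a list \<Rightarrow> bool" where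
  "weakly_compressible A R \<alpha> \<longleftrightarrow>
     \<alpha> \<in> lists A \<and> \<alpha> \<noteq> [] \<and> self_overlap_free \<alpha> \<and> (\<forall>p\<in>R. sealed A \<alpha> p)"

definition Sigma_star :: "'a set \<Rightarrow> 'a list \<Rightarrow> 'a list set" where
  "Sigma_star A \<alpha> = {\<alpha> @ x | x. x \<in> lists A \<and> \<not> sublist \<alpha> x}"

text \<open>
  The symbol \<open>\<gamma>\<^sub>w\<close> is taken to be the word \<open>w\<close> itself, now regarded as a single letter. So the
  alphabet \<open>\<Gamma>\<^sub>*\<close> is \<^term>\<open>Sigma_star A \<alpha>\<close>, words over it have type \<^typ>\<open>'a list list\<close>,
  and the isomorphism \<open>\<phi>\<close> is the inverse of \<^const>\<open>concat\<close>. For \<open>u\<close> in \<open>\<Sigma>\<^sub>*\<^sup>*\<alpha>\<close>, which is where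
  it is used, \<open>left_word A \<alpha> u\<close> is \<open>\<phi>(u\<^sub>1 \<dots> u\<^sub>m)\<close>, where \<open>u = u\<^sub>1 \<dots> u\<^sub>m \<alpha>\<close> is the unique
  factorisation with all \<open>u\<^sub>j\<close> in \<open>\<Sigma>\<^sub>*\<close>.
\<close>

definition left_word :: "'a set \<Rightarrow> 'a list \<Rightarrow> 'a list \<Rightarrow> 'a list list" where
  "left_word A \<alpha> u = (THE us. us \<in> lists (Sigma_star A \<alpha>) \<and> u = concat us @ \<alpha>)"

definition left_relations ::
    "'a set \<Rightarrow> ('a list \<times> 'a list) set \<Rightarrow> 'a list \<Rightarrow> ('a list list \<times> 'a list list) set" where
  "left_relations A R \<alpha> = (\<lambda>(u, v). (left_word A \<alpha> u, left_word A \<alpha> v)) ` R"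

definition left_generators :: "'a set \<Rightarrow> ('a list \<times> 'a list) set \<Rightarrow> 'a list \<Rightarrow> 'a list set" where
  "left_generators A R \<alpha> =
     (\<Union>(u, v)\<in>R. set (left_word A \<alpha> u) \<union> set (left_word A \<alpha> v))"

definition extended_left_monoid ::
    "'a set \<Rightarrow> ('a list \<times> 'a list) set \<Rightarrow> 'a list \<Rightarrow> 'a list list set monoid" where
  "extended_left_monoid A R \<alpha> =
     presented_monoid (Sigma_star A \<alpha>) (left_relations A R \<alpha>)"

definition left_monoid ::
    "'a set \<Rightarrow> ('a list \<times> 'a list) set \<Rightarrow> 'a list \<Rightarrow> 'a list list set monoid" where
  "left_monoid A R \<alpha> =
     submonoid_generated (extended_left_monoid A R \<alpha>)
       ((\<lambda>\<gamma>. pres_cong (Sigma_star A \<alpha>) (left_relations A R \<alpha>) `` {[\<gamma>]}) ` left_generators A R \<alpha>)"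

end

theory Submission
  imports Defs
begin

text \<open>
  Since \<open>\<alpha>\<close> does not overlap itself, every word factors uniquely as \<open>p \<sigma>\<^sub>1 \<dots> \<sigma>\<^sub>k\<close> with \<open>p\<close> free of
  \<open>\<alpha>\<close> and all \<open>\<sigma>\<^sub>i\<close> in \<open>\<Sigma>\<^sub>*\<close>, and an application of a relation changes neither \<open>p\<close> nor \<open>\<sigma>\<^sub>k\<close>: two words
  with \<open>k > 0\<close> are equal in \<open>M\<close> iff they agree in \<open>p\<close> and \<open>\<sigma>\<^sub>k\<close> and the remaining factors are equal in
  \<open>L\<^sub>*(M)\<close>. In particular \<open>g = g'\<close> in \<open>L(M)\<close> iff \<open>\<phi>\<^sup>-\<^sup>1(g) \<alpha> = \<phi>\<^sup>-\<^sup>1(g') \<alpha>\<close> in \<open>M\<close>, so the word problem of \<open>L(M)\<close>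
  is an inverse homomorphic image of that of \<open>M\<close>, up to an intersection with a regular language.
  Conversely, \<open>L\<^sub>*(M)\<close> is the free product of \<open>L(M)\<close> and a free monoid. Hence the equal pairs in \<open>L\<^sub>*(M)\<close>
  are the products of pairs \<open>(t, t)\<close> with \<open>t \<in> \<Sigma>\<^sub>*\<close> and of equal pairs in \<open>L(M)\<close>, and monadic rewriting
  peels these off around the separator, from the inside to the outside.
\<close>

section \<open>Homomorphic images of members of a class of languages\<close>

lemma hom_ext_Nil [simp]: "hom_ext h [] = []"
  and hom_ext_Cons [simp]: "hom_ext h (a # w) = h a @ hom_ext h w"
  and hom_ext_append [simp]: "hom_ext h (u @ v) = hom_ext h u @ hom_ext h v"
  by (simp_all add: hom_ext_def)

lemma hom_ext_map: "hom_ext h (map f w) = hom_ext (h \<circ> f) w"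
  by (simp add: hom_ext_def)

lemma map_hom_ext: "map f (hom_ext h w) = hom_ext (map f \<circ> h) w"
  by (induction w) auto

lemma hom_ext_hom_ext: "hom_ext g (hom_ext h w) = hom_ext (hom_ext g \<circ> h) w"
  by (induction w) auto

lemma hom_ext_single: "hom_ext (\<lambda>x. [f x]) w = map f w"
  by (induction w) auto

lemma hom_ext_cong: "(\<And>x. x \<in> set w \<Longrightarrow> g x = h x) \<Longrightarrow> hom_ext g w = hom_ext h w"
  by (induction w) auto

lemma rev_hom_ext: "rev (hom_ext h w) = hom_ext (rev \<circ> h) (rev w)"
  by (induction w) auto

lemma hom_ext_in_lists: "w \<in> lists A \<Longrightarrow> (\<And>a. a \<in> A \<Longrightarrow> h a \<in> lists B) \<Longrightarrow> hom_ext h w \<in> lists B"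
  by (induction w) auto

lemma finite_nat_encoding:
  assumes "finite A"
  obtains e :: "'a \<Rightarrow> nat" and d where "\<And>x. x \<in> A \<Longrightarrow> d (e x) = x"
proof -
  obtain e :: "'a \<Rightarrow> nat" where "inj_on e A"
    using finite_imp_inj_to_nat_seg[OF assms] by blast
  then have "\<And>x. x \<in> A \<Longrightarrow> inv_into A e (e x) = x" by simp
  then show thesis using that by blast
qed

lemma map_inverse_on: "u \<in> lists A \<Longrightarrow> (\<And>x. x \<in> A \<Longrightarrow> d (e x) = x) \<Longrightarrow> map d (map e u) = u"
  by (induction u) auto

text \<open>\<open>C\<close> consists of languages over \<open>nat\<close>, while the languages
  below use other symbol types. An AFL is closed under homomorphisms, so the choice of a coding by
  numbers does not matter, and for \<open>nat\<close> words the notion is membership in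
  \<open>C\<close> (\<open>lang_in_nat\<close>).\<close>

definition lang_in :: "nat list set set \<Rightarrow> 'a list set \<Rightarrow> bool" where
  "lang_in C L \<longleftrightarrow> (\<exists>K\<in>C. \<exists>h. L = hom_ext h ` K)"

section \<open>AFL closure properties over arbitrary symbol types\<close>

locale afl =
  fixes C :: "nat list set set"
  assumes AFL: "AFL C" and nonempty: "C \<noteq> {}"
begin

lemma
  shows C_alphabet: "L \<in> C \<Longrightarrow> \<exists>A. finite A \<and> L \<subseteq> lists A"
    and C_hom: "L \<in> C \<Longrightarrow> hom_ext h ` L \<in> C"
    and C_inverse_hom: "L \<in> C \<Longrightarrow> finite A \<Longrightarrow> {w \<in> lists A. hom_ext h w \<in> L} \<in> C"
    and C_Int_regular: "L \<in> C \<Longrightarrow> regular K \<Longrightarrow> L \<inter> K \<in> C"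
    and C_Un: "L \<in> C \<Longrightarrow> K \<in> C \<Longrightarrow> L \<union> K \<in> C"
    and C_append: "L \<in> C \<Longrightarrow> K \<in> C \<Longrightarrow> {u @ v | u v. u \<in> L \<and> v \<in> K} \<in> C"
    and C_star: "L \<in> C \<Longrightarrow> concat ` lists L \<in> C"
  using AFL by (simp_all add: AFL_def)

lemma lang_in_nat: "lang_in C L \<longleftrightarrow> L \<in> C"
proof
  show "lang_in C L \<Longrightarrow> L \<in> C" using C_hom unfolding lang_in_def by auto
  assume "L \<in> C"
  moreover have "L = hom_ext (\<lambda>x. [x]) ` L" by (simp add: hom_ext_single)
  ultimately show "lang_in C L" unfolding lang_in_def by blast
qed

lemma lang_in_hom: "lang_in C L \<Longrightarrow> lang_in C (hom_ext h ` L)"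
  unfolding lang_in_def by (force simp: image_image hom_ext_hom_ext)

lemma lang_in_map: "lang_in C L \<Longrightarrow> lang_in C (map f ` L)"
  using lang_in_hom[of L "\<lambda>x. [f x]"] by (simp add: hom_ext_single)

lemma lang_in_alphabet:
  assumes "lang_in C L"
  obtains A where "finite A" "L \<subseteq> lists A"
proof -
  obtain K h where K: "K \<in> C" "L = hom_ext h ` K" using assms unfolding lang_in_def by blast
  then obtain B where B: "finite B" "K \<subseteq> lists B" using C_alphabet by metis
  have "L \<subseteq> lists (\<Union>b\<in>B. set (h b))"
  proof
    fix w assume "w \<in> L"
    then obtain v where v: "v \<in> K" "w = hom_ext h v" using K(2) by blast
    show "w \<in> lists (\<Union>b\<in>B. set (h b))"
      unfolding v(2) using v(1) B(2) by (intro hom_ext_in_lists[of _ B]) auto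
  qed
  with B(1) show thesis by (intro that[of "\<Union>b\<in>B. set (h b)"]) auto
qed

text \<open>The way back from numbers to symbols: \<open>map d\<close> is a homomorphism that undoes
  the coding on all of \<open>L\<close>.\<close>

lemma lang_in_decode:
  assumes "map e ` L \<in> C" "L \<subseteq> lists A" "\<And>x. x \<in> A \<Longrightarrow> d (e x) = x"
  shows "lang_in C L"
proof -
  have "map d (map e w) = w" if "w \<in> L" for w
    using that assms(2,3) by (intro map_inverse_on) auto
  then have "map d ` map e ` L = L" by (auto simp: image_iff)
  then show ?thesis using lang_in_map[of "map e ` L" d] assms(1) lang_in_nat by simp
qed

lemma lang_in_inverse_hom:
  fixes h :: "'b \<Rightarrow> 'a list"
  assumes L: "lang_in C L" and A: "finite A"
  shows "lang_in C {w \<in> lists A. hom_ext h w \<in> L}"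
proof -
  obtain U where U: "finite U" "L \<subseteq> lists U" using lang_in_alphabet[OF L] .
  \<comment> \<open>The code has to be injective on the letters of all words \<open>h a\<close> too,
    not only on those of \<open>L\<close>; otherwise some \<open>hom_ext h w\<close> outside
    \<open>L\<close> could share its code with a word of \<open>L\<close>.\<close>
  define V where "V = U \<union> (\<Union>a\<in>A. set (h a))"
  have "finite V" using U A by (simp add: V_def)
  then obtain e :: "'a \<Rightarrow> nat" and d where ed: "\<And>x. x \<in> V \<Longrightarrow> d (e x) = x"
    using finite_nat_encoding by metis
  obtain e' :: "'b \<Rightarrow> nat" and d' where ed': "\<And>x. x \<in> A \<Longrightarrow> d' (e' x) = x"
    using finite_nat_encoding[OF A] by metis
  define K where "K = {w \<in> lists (e' ` A). hom_ext (map e \<circ> h \<circ> d') w \<in> map e ` L}"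
  have "map e ` L \<in> C" using lang_in_map[OF L, of e] lang_in_nat by simp
  then have "K \<in> C" using A unfolding K_def by (intro C_inverse_hom) auto
  have mem: "hom_ext (map e \<circ> h \<circ> d') (map e' w) \<in> map e ` L \<longleftrightarrow> hom_ext h w \<in> L"
    if w: "w \<in> lists A" for w
  proof -
    have "hom_ext (map e \<circ> h \<circ> d') (map e' w) = hom_ext (map e \<circ> h) w"
      unfolding hom_ext_map using w ed' by (intro hom_ext_cong) auto
    then have eq: "hom_ext (map e \<circ> h \<circ> d') (map e' w) = map e (hom_ext h w)"
      by (simp add: map_hom_ext)
    have "hom_ext h w \<in> lists V" using w by (intro hom_ext_in_lists[of _ A]) (auto simp: V_def)
    moreover have "L \<subseteq> lists V" using U(2) by (auto simp: V_def)
    ultimately show ?thesis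
      unfolding eq using map_inverse_on[where e = e and d = d and A = V] ed
      by (smt (verit, best) image_iff subset_iff)
  qed
  have "K = map e' ` {w \<in> lists A. hom_ext h w \<in> L}"
  proof (intro equalityI subsetI)
    fix x assume x: "x \<in> K"
    then obtain w where "x = map e' w" "w \<in> lists A"
      unfolding K_def by (auto simp: lists_image)
    with x mem show "x \<in> map e' ` {w \<in> lists A. hom_ext h w \<in> L}" by (auto simp: K_def)
  qed (use mem in \<open>auto simp: K_def\<close>)
  with \<open>K \<in> C\<close> show ?thesis by (intro lang_in_decode[of e' _ A d']) (auto simp: ed')
qed

text \<open>The map \<open>f\<close> is the state reached by a deterministic automaton that recognises \<open>K\<close>.\<close>

lemma lang_in_Int_regular:
  fixes f :: "'a list \<Rightarrow> 'q"
  assumes L: "lang_in C L" and A: "finite A" and fin: "finite (f ` lists A)"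
    and step: "\<And>u v a. u \<in> lists A \<Longrightarrow> v \<in> lists A \<Longrightarrow> a \<in> A \<Longrightarrow> f u = f v \<Longrightarrow> f (u @ [a]) = f (v @ [a])"
    and final: "\<And>u v. u \<in> lists A \<Longrightarrow> v \<in> lists A \<Longrightarrow> f u = f v \<Longrightarrow> u \<in> K \<Longrightarrow> v \<in> K"
  shows "lang_in C {w \<in> L. w \<in> lists A \<and> w \<in> K}"
proof -
  obtain U where U: "finite U" "L \<subseteq> lists U" using lang_in_alphabet[OF L] .
  define V where "V = U \<union> A"
  have "finite V" using U A by (simp add: V_def)
  then obtain e :: "'a \<Rightarrow> nat" and d where ed: "\<And>x. x \<in> V \<Longrightarrow> d (e x) = x"
    using finite_nat_encoding by metis
  have inj: "map e u = map e v \<longleftrightarrow> u = v" if "u \<in> lists V" "v \<in> lists V" for u v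
    using that map_inverse_on[where e = e and d = d and A = V] ed by metis
  obtain s :: "'q \<Rightarrow> nat" and s' where ss: "\<And>x. x \<in> f ` lists A \<Longrightarrow> s' (s x) = x"
    using finite_nat_encoding[OF fin] by metis
  \<comment> \<open>The states of the automaton are numbers, so its transitions are computed on some
    word \<open>rep q\<close> that leads to the state \<open>q\<close>. By the assumption
    \<open>step\<close> the choice of this word does not matter.\<close>
  define rep where "rep q = (SOME u. u \<in> lists A \<and> s (f u) = q)" for q
  have rep: "rep (s (f u)) \<in> lists A" "f (rep (s (f u))) = f u" if "u \<in> lists A" for u
  proof -
    have "rep (s (f u)) \<in> lists A \<and> s (f (rep (s (f u)))) = s (f u)"
      unfolding rep_def using that by (intro someI_ex[of "\<lambda>v. v \<in> lists A \<and> s (f v) = s (f u)"]) auto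
    then show "rep (s (f u)) \<in> lists A" "f (rep (s (f u))) = f u"
      using ss that by (blast, metis imageI)
  qed
  define \<delta> where "\<delta> q b = s (f (rep q @ [d b]))" for q b
  define Q where "Q = s ` f ` lists A"
  define F where "F = s ` f ` (lists A \<inter> K)"
  have dA: "d (e a) = a" if "a \<in> A" for a using that ed by (simp add: V_def)
  have fold: "foldl \<delta> (s (f [])) (map e w) = s (f w)" if "w \<in> lists A" for w
    using that
  proof (induction w rule: rev_induct)
    case (snoc a w)
    then have aw: "a \<in> A" "w \<in> lists A" by auto
    then have "f (rep (s (f w)) @ [a]) = f (w @ [a])" using rep by (intro step) auto
    with snoc.IH aw show ?case by (simp add: \<delta>_def dA)
  qed simp
  have "regular {x \<in> lists (e ` A). foldl \<delta> (s (f [])) x \<in> F}" (is "regular ?K")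
    unfolding regular_def
  proof (intro exI conjI)
    show "\<forall>q\<in>Q. \<forall>a\<in>e ` A. \<delta> q a \<in> Q"
      using rep by (auto simp: Q_def \<delta>_def dA intro!: imageI)
  qed (use A fin in \<open>auto simp: Q_def F_def\<close>)
  moreover have "map e ` L \<in> C" using lang_in_map[OF L, of e] lang_in_nat by simp
  ultimately have "map e ` L \<inter> ?K \<in> C" by (intro C_Int_regular)
  moreover have "map e ` L \<inter> ?K = map e ` {w \<in> L. w \<in> lists A \<and> w \<in> K}"
  proof (intro equalityI subsetI)
    fix x assume x: "x \<in> map e ` L \<inter> ?K"
    then obtain w where w: "w \<in> lists A" "x = map e w" by (auto simp: lists_image)
    obtain w' where w': "w' \<in> L" "x = map e w'" using x by blast
    have "w = w'" using inj[of w w'] w w' U(2) by (auto simp: V_def)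
    have "s (f w) \<in> F" using x w fold by auto
    then obtain v where "v \<in> lists A" "v \<in> K" "s (f w) = s (f v)" unfolding F_def by blast
    then have "w \<in> K" using final[of v w] ss w by (metis imageI)
    then show "x \<in> map e ` {w \<in> L. w \<in> lists A \<and> w \<in> K}" using w w' \<open>w = w'\<close> by blast
  next
    fix x assume "x \<in> map e ` {w \<in> L. w \<in> lists A \<and> w \<in> K}"
    then obtain w where w: "w \<in> L" "w \<in> lists A" "w \<in> K" "x = map e w" by blast
    then have "foldl \<delta> (s (f [])) x \<in> F" using fold[of w] by (auto simp: F_def)
    moreover have "x \<in> lists (e ` A)" using w by auto
    ultimately show "x \<in> map e ` L \<inter> ?K" using w by blast
  qed
  ultimately show ?thesis
    using U(2) by (intro lang_in_decode[of e _ V d]) (auto simp: ed V_def)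
qed

lemma lang_in_lists_Int:
  assumes "lang_in C L" "finite A"
  shows "lang_in C (L \<inter> lists A)"
  using lang_in_Int_regular[OF assms, of "\<lambda>_. ()" UNIV]
  by (simp add: Int_def)

text \<open>Union and concatenation are taken inside \<open>C\<close>, which requires both languages
  to be coded by one map that is injective on the union of their alphabets.\<close>

lemma common_encoding:
  assumes "lang_in C L" "lang_in C K"
  shows "\<exists>(e :: 'a \<Rightarrow> nat) d A. finite A \<and> L \<subseteq> lists A \<and> K \<subseteq> lists A \<and> (\<forall>x\<in>A. d (e x) = x) \<and>
           map e ` L \<in> C \<and> map e ` K \<in> C"
proof -
  obtain U where U: "finite U" "L \<subseteq> lists U" using lang_in_alphabet[OF assms(1)] .
  obtain V where V: "finite V" "K \<subseteq> lists V" using lang_in_alphabet[OF assms(2)] .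
  obtain e :: "'a \<Rightarrow> nat" and d where "\<And>x. x \<in> U \<union> V \<Longrightarrow> d (e x) = x"
    using finite_nat_encoding[of "U \<union> V"] U V by (metis finite_UnI)
  moreover have "map e ` L \<in> C" "map e ` K \<in> C"
    using lang_in_map[OF assms(1), of e] lang_in_map[OF assms(2), of e] lang_in_nat by simp_all
  moreover have "L \<subseteq> lists (U \<union> V)" "K \<subseteq> lists (U \<union> V)" using U V by auto
  ultimately show ?thesis using U V by (metis finite_UnI)
qed

lemma lang_in_Un:
  assumes "lang_in C L" "lang_in C K"
  shows "lang_in C (L \<union> K)"
proof -
  obtain e :: "'a \<Rightarrow> nat" and d A where
    *: "finite A" "L \<subseteq> lists A" "K \<subseteq> lists A" "\<forall>x\<in>A. d (e x) = x" "map e ` L \<in> C" "map e ` K \<in> C"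
    using common_encoding[OF assms] by blast
  then have "map e ` (L \<union> K) \<in> C" unfolding image_Un by (intro C_Un)
  with * show ?thesis by (intro lang_in_decode[of e _ A d]) auto
qed

lemma lang_in_append:
  assumes "lang_in C L" "lang_in C K"
  shows "lang_in C {u @ v | u v. u \<in> L \<and> v \<in> K}"
proof -
  obtain e :: "'a \<Rightarrow> nat" and d A where
    *: "finite A" "L \<subseteq> lists A" "K \<subseteq> lists A" "\<forall>x\<in>A. d (e x) = x" "map e ` L \<in> C" "map e ` K \<in> C"
    using common_encoding[OF assms] by blast
  have "map e ` {u @ v | u v. u \<in> L \<and> v \<in> K} = {u @ v | u v. u \<in> map e ` L \<and> v \<in> map e ` K}"
    by (auto simp: image_iff) (metis map_append)+
  then have "map e ` {u @ v | u v. u \<in> L \<and> v \<in> K} \<in> C" using C_append[OF *(5,6)] by simp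
  with * show ?thesis by (intro lang_in_decode[of e _ A d]) fastforce+
qed

text \<open>Some member of \<open>C\<close>, which exists by \<open>nonempty\<close>, is intersected
  with the empty regular language. The result is a language over \<open>nat\<close>; a homomorphism
  carries it to any other symbol type.\<close>

lemma lang_in_empty: "lang_in C {}"
proof -
  obtain L where "L \<in> C" using nonempty by blast
  then have "lang_in C L" using lang_in_nat by blast
  then have "lang_in C ({} :: nat list set)"
    using lang_in_Int_regular[of L "{}" "\<lambda>_. ()" "{}"] by simp
  then show ?thesis using lang_in_hom[of "{}"] by simp
qed

text \<open>The star of the empty language is \<open>{[]}\<close>. Its inverse image under the
  erasing homomorphism on a one-letter alphabet contains all words, an automaton selects the word of
  length 1, and a homomorphism sends its letter to \<open>w\<close>.\<close>

lemma lang_in_singleton: "lang_in C {w}"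
proof -
  have "{} \<in> C" using lang_in_empty lang_in_nat by blast
  then have "concat ` lists {} \<in> C" by (rule C_star)
  then have "lang_in C {[] :: nat list}" by (simp add: lang_in_nat)
  then have "lang_in C {w \<in> lists {()}. hom_ext (\<lambda>_. []) w \<in> {[] :: nat list}}"
    by (intro lang_in_inverse_hom) auto
  moreover have "hom_ext (\<lambda>_. []) w = ([] :: nat list)" for w :: "unit list" by (induction w) auto
  ultimately have "lang_in C (lists {()})" by simp
  then have "lang_in C {w \<in> lists {()}. w \<in> lists {()} \<and> w \<in> {[()]}}"
    by (rule lang_in_Int_regular[where f = "\<lambda>w. (w = [], w = [()])"]) auto
  then have "lang_in C (hom_ext (\<lambda>_. w) ` {[()]})"
    by (intro lang_in_hom) (smt (verit, best) Collect_cong UNIV_unit UNIV_I in_lists_conv_set singleton_conv singleton_iff)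
  then show ?thesis by simp
qed

lemma lang_in_finite: "finite L \<Longrightarrow> lang_in C L"
proof (induction rule: finite_induct)
  case (insert w L)
  then show ?case using lang_in_Un[OF lang_in_singleton[of w] insert.IH] by simp
qed (rule lang_in_empty)

end

section \<open>Monadic rewriting over arbitrary symbol types\<close>

lemma rewrite_step_map:
  assumes "(w, x) \<in> (rewrite_step A R)\<^sup>*"
  shows "(map f w, map f x) \<in> (rewrite_step (f ` A) (map_prod (map f) (map f) ` R))\<^sup>*"
  using assms
proof (induction rule: rtrancl_induct)
  case (step y z)
  then obtain p q l r where *: "y = p @ l @ q" "z = p @ r @ q" "(l, r) \<in> R" "p \<in> lists A" "q \<in> lists A"
    unfolding rewrite_step_def by blast
  have "(map f y, map f z) \<in> rewrite_step (f ` A) (map_prod (map f) (map f) ` R)"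
  proof -
    have "(map f l, map f r) \<in> map_prod (map f) (map f) ` R" using *(3) by force
    moreover have "map f p \<in> lists (f ` A)" "map f q \<in> lists (f ` A)" using *(4,5) by auto
    ultimately show ?thesis unfolding *(1,2) map_append rewrite_step_def by blast
  qed
  with step.IH show ?case by simp
qed simp

locale super_afl = afl +
  assumes ancestors_closed: "monadic_ancestor_property C"
begin

text \<open>Symbols and rules are coded by numbers. By \<open>rewrite_step_map\<close>, derivations
  are carried over by \<open>e\<close> and brought back by \<open>d\<close>, so that coding commutes
  with taking ancestors.\<close>

lemma lang_in_ancestors:
  assumes L: "lang_in C L" "L \<subseteq> lists A" and A: "finite A" and R: "monadic A R"
    and rules: "\<And>r. lang_in C {l. (l, r) \<in> R}"
  shows "lang_in C (ancestors A R L)"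
proof -
  obtain e :: "'a \<Rightarrow> nat" and d where ed: "\<And>x. x \<in> A \<Longrightarrow> d (e x) = x"
    using finite_nat_encoding[OF A] by metis
  have de: "map d (map e w) = w" if "w \<in> lists A" for w
    using that ed by (rule map_inverse_on)
  have RA: "R \<subseteq> lists A \<times> lists A" using R by (simp add: monadic_def)
  define S where "S = map_prod (map e) (map e) ` R"
  have dS: "map_prod (map d) (map d) ` S = R"
  proof -
    have "map_prod (map d) (map d) (map_prod (map e) (map e) p) = p" if "p \<in> R" for p
    proof -
      obtain u v where "p = (u, v)" "u \<in> lists A" "v \<in> lists A" using \<open>p \<in> R\<close> RA by blast
      then show ?thesis using de by (simp del: map_map)
    qed
    then show ?thesis unfolding S_def image_image by simp
  qed
  have dA: "d ` e ` A = A" using ed by (simp add: image_image)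
  have "monadic (e ` A) S"
    unfolding monadic_def
  proof (intro conjI subsetI ballI)
    fix p assume "p \<in> S"
    then obtain u v where p: "p = (map e u, map e v)" "(u, v) \<in> R" by (auto simp: S_def)
    then have "u \<in> lists A" "v \<in> lists A" using RA by blast+
    then show "p \<in> lists (e ` A) \<times> lists (e ` A)" by (auto simp: p(1))
    have "length v \<le> length u" "v \<in> letters_or_empty A" using R p(2) by (auto simp: monadic_def)
    then show "case p of (u, v) \<Rightarrow> length v \<le> length u \<and> v \<in> letters_or_empty (e ` A)"
      by (auto simp: p(1) letters_or_empty_def)
  qed
  moreover have "{u. (u, r) \<in> S} \<in> C" if r: "r \<in> letters_or_empty (e ` A)" for r
  proof -
    have "{u. (u, r) \<in> S} = map e ` {l. (l, map d r) \<in> R}"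
    proof (intro equalityI subsetI)
      fix u assume "u \<in> {u. (u, r) \<in> S}"
      then obtain l r' where l: "(l, r') \<in> R" "u = map e l" "r = map e r'" by (auto simp: S_def)
      then have "r' \<in> lists A" using RA by blast
      then have "map d r = r'" using de l(3) by (simp del: map_map)
      then have "(l, map d r) \<in> R" using l(1) by simp
      then show "u \<in> map e ` {l. (l, map d r) \<in> R}" using l(2) by blast
    next
      fix u assume "u \<in> map e ` {l. (l, map d r) \<in> R}"
      then obtain l where l: "(l, map d r) \<in> R" "u = map e l" by fast
      have "map e (map d r) = r" using r ed by (auto simp: letters_or_empty_def)
      then have "(u, r) = map_prod (map e) (map e) (l, map d r)" using l(2) by (simp del: map_map)
      then show "u \<in> {u. (u, r) \<in> S}" using l(1) unfolding S_def by blast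
    qed
    then show ?thesis using lang_in_map[OF rules, of e] lang_in_nat by simp
  qed
  moreover have "map e ` L \<in> C" using lang_in_map[OF L(1)] lang_in_nat by blast
  moreover have "map e ` L \<subseteq> lists (e ` A)" using L(2) by (auto simp: lists_image)
  ultimately have "ancestors (e ` A) S (map e ` L) \<in> C"
    using ancestors_closed A
    unfolding monadic_ancestor_property_def monadic_system_def by blast
  moreover have "ancestors (e ` A) S (map e ` L) = map e ` ancestors A R L"
  proof (intro equalityI subsetI)
    fix w assume "w \<in> ancestors (e ` A) S (map e ` L)"
    then obtain x where x: "w \<in> lists (e ` A)" "x \<in> L" "(w, map e x) \<in> (rewrite_step (e ` A) S)\<^sup>*"
      by (auto simp: ancestors_def)
    obtain v where v: "v \<in> lists A" "w = map e v" using x(1) by (auto simp: lists_image)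
    have "x \<in> lists A" using x(2) L(2) by blast
    then have "(v, x) \<in> (rewrite_step A R)\<^sup>*"
      using rewrite_step_map[OF x(3), of d] v(1) by (simp add: v(2) de dA dS del: map_map)
    with v x(2) show "w \<in> map e ` ancestors A R L" by (auto simp: ancestors_def)
  next
    fix w assume "w \<in> map e ` ancestors A R L"
    then obtain v x where v: "w = map e v" "v \<in> lists A" "x \<in> L" "(v, x) \<in> (rewrite_step A R)\<^sup>*"
      by (auto simp: ancestors_def)
    then have "(w, map e x) \<in> (rewrite_step (e ` A) S)\<^sup>*"
      using rewrite_step_map[OF v(4), of e] by (simp add: S_def)
    moreover have "w \<in> lists (e ` A)" using v by auto
    ultimately show "w \<in> ancestors (e ` A) S (map e ` L)"
      using v by (auto simp: ancestors_def)
  qed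
  ultimately show ?thesis
    by (intro lang_in_decode[of e _ A d]) (auto simp: ancestors_def ed)
qed

end

section \<open>Relations on words\<close>

text \<open>
  A pair \<open>(u, v)\<close> of words is encoded by \<open>u # v\<^sup>r\<^sup>e\<^sup>v\<close>. The letters of \<open>u\<close> and \<open>v\<close> are taken from
  disjoint copies of the alphabet, because a homomorphism cannot tell the two sides apart
  otherwise; of the two separators, \<open>Mark True\<close> is a nonterminal of the rewriting systems below.
\<close>

datatype 'a letter = Lft 'a | Rgt 'a | Mark bool

definition enc :: "bool \<Rightarrow> 'a list \<Rightarrow> 'a list \<Rightarrow> 'a letter list" where
  "enc b u v = map Lft u @ Mark b # map Rgt (rev v)"

definition enc_rel :: "bool \<Rightarrow> ('a list \<times> 'a list) set \<Rightarrow> 'a letter list set" where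
  "enc_rel b P = (\<lambda>(u, v). enc b u v) ` P"

definition rel_in :: "nat list set set \<Rightarrow> ('a list \<times> 'a list) set \<Rightarrow> bool" where
  "rel_in C P \<longleftrightarrow> lang_in C (enc_rel False P)"

definition letters_over :: "'a set \<Rightarrow> 'a letter set" where
  "letters_over A = Lft ` A \<union> Rgt ` A \<union> range Mark"

lemma map_Lft_eq_iff [simp]: "map Lft u = map Lft v \<longleftrightarrow> u = v"
  and map_Rgt_eq_iff [simp]: "map Rgt u = map Rgt v \<longleftrightarrow> u = v"
  by (simp_all add: inj_map_eq_map inj_def)

text \<open>An encoded pair contains exactly one mark, so any split at a mark is the split at its
  separator. This determines where a rewriting step has taken place.\<close>

lemma append_Mark_eq_enc_iff:
  "x @ Mark c # y = enc b u v \<longleftrightarrow> c = b \<and> x = map Lft u \<and> y = map Rgt (rev v)"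
proof
  assume eq: "x @ Mark c # y = enc b u v"
  then have "Mark c \<in> set (enc b u v)" by (metis in_set_conv_decomp)
  then have "c = b" by (auto simp: enc_def)
  then show "c = b \<and> x = map Lft u \<and> y = map Rgt (rev v)"
    using eq append_Cons_eq_iff[of "Mark c" "map Lft u" "map Rgt (rev v)" x y]
    by (auto simp: enc_def)
qed (simp add: enc_def)

lemma enc_eq_iff [simp]: "enc b u v = enc b' u' v' \<longleftrightarrow> b = b' \<and> u = u' \<and> v = v'"
  using append_Mark_eq_enc_iff[of "map Lft u" b "map Rgt (rev v)" b' u' v']
  by (auto simp: enc_def)

lemma enc_in_enc_rel [simp]: "enc b u v \<in> enc_rel b' P \<longleftrightarrow> b = b' \<and> (u, v) \<in> P"
  by (auto simp: enc_rel_def)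

lemma set_enc: "set (enc b u v) = Lft ` set u \<union> {Mark b} \<union> Rgt ` set v"
  by (auto simp: enc_def)

lemma enc_in_lists [simp]: "enc b u v \<in> lists (letters_over A) \<longleftrightarrow> u \<in> lists A \<and> v \<in> lists A"
  by (auto simp: enc_def letters_over_def in_lists_conv_set)

lemma finite_letters_over: "finite A \<Longrightarrow> finite (letters_over A)"
  by (simp add: letters_over_def)

lemma enc_append: "enc b (u @ x) (v @ y) = map Lft u @ enc b x y @ map Rgt (rev v)"
  by (simp add: enc_def)

section \<open>Closure properties for relations on words\<close>

context afl
begin

lemma enc_rel_change_mark:
  assumes "lang_in C (enc_rel b P)"
  shows "lang_in C (enc_rel b' P)"
proof -
  let ?f = "case_letter Lft Rgt (\<lambda>_. Mark b')"
  have "map ?f (enc b u v) = enc b' u v" for u v :: "'a list"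
    by (simp add: enc_def)
  then have "map ?f ` enc_rel b P = enc_rel b' P"
    unfolding enc_rel_def image_image by (intro image_cong) auto
  then show ?thesis using lang_in_map[OF assms, of ?f] by simp
qed

lemma rel_in_alphabet:
  assumes "rel_in C P"
  obtains A where "finite A" "P \<subseteq> lists A \<times> lists A"
proof -
  obtain U where U: "finite U" "enc_rel False P \<subseteq> lists U"
    using lang_in_alphabet assms unfolding rel_in_def by metis
  define A where "A = Lft -` U \<union> Rgt -` U"
  have "finite A" unfolding A_def using U(1) by (auto intro!: finite_vimageI injI)
  moreover have "P \<subseteq> lists A \<times> lists A"
  proof
    fix p assume "p \<in> P"
    moreover obtain u v where "p = (u, v)" by fastforce
    ultimately have "enc False u v \<in> lists U" using U(2) by (metis enc_in_enc_rel subsetD)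
    then show "p \<in> lists A \<times> lists A"
      using \<open>p = (u, v)\<close> by (auto simp: enc_def A_def in_lists_conv_set)
  qed
  ultimately show thesis by (rule that)
qed

lemma rel_in_Un: "rel_in C P \<Longrightarrow> rel_in C Q \<Longrightarrow> rel_in C (P \<union> Q)"
  unfolding rel_in_def enc_rel_def image_Un by (rule lang_in_Un)

lemma rel_in_finite: "finite P \<Longrightarrow> rel_in C P"
  unfolding rel_in_def enc_rel_def by (rule lang_in_finite) simp

lemma rel_in_hom:
  assumes "rel_in C P"
  shows "rel_in C ((\<lambda>(u, v). (hom_ext f u, hom_ext f v)) ` P)"
proof -
  \<comment> \<open>The right component is written backwards, hence the reversed images of its
    letters.\<close>
  let ?h = "case_letter (map Lft \<circ> f) (map Rgt \<circ> rev \<circ> f) (\<lambda>b. [Mark b])"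
  have "hom_ext ?h (enc b u v) = enc b (hom_ext f u) (hom_ext f v)" for b u v
    by (simp add: enc_def hom_ext_map map_hom_ext rev_hom_ext comp_def)
  then have "hom_ext ?h ` enc_rel False P = enc_rel False ((\<lambda>(u, v). (hom_ext f u, hom_ext f v)) ` P)"
    unfolding enc_rel_def image_image by (intro image_cong) auto
  then show ?thesis using lang_in_hom[of _ ?h] assms unfolding rel_in_def by metis
qed

lemma rel_in_append_left:
  assumes "rel_in C P"
  shows "rel_in C ((\<lambda>(u, v). (s @ u, t @ v)) ` P)"
proof -
  have eq: "enc_rel False ((\<lambda>(u, v). (s @ u, t @ v)) ` P) =
      {x @ y |x y. x \<in> {x @ y |x y. x \<in> {map Lft s} \<and> y \<in> enc_rel False P} \<and> y \<in> {map Rgt (rev t)}}"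
    by (auto simp: enc_rel_def enc_append image_iff) (metis append.assoc case_prod_conv enc_append)+
  then show ?thesis
    using assms unfolding rel_in_def eq by (intro lang_in_append lang_in_singleton)
qed

text \<open>A word in the inverse image need not encode a pair, so the inverse image is intersected
  with the regular set \<open>K\<close> of encoded pairs. As \<open>h\<close> may treat the two
  sides and the separator differently, this lemma covers all inverse images needed later.\<close>

lemma rel_in_inverse_hom:
  assumes L: "lang_in C L" and A: "finite A"
  shows "rel_in C {(u, v). u \<in> lists A \<and> v \<in> lists A \<and> hom_ext h (enc False u v) \<in> L}" (is "rel_in C ?P")
proof -
  let ?A = "letters_over A"
  let ?L = "{w \<in> lists ?A. hom_ext h w \<in> L}"
  define K where "K = enc_rel False (lists A \<times> lists A)"
  have Lft_snoc: "w @ [a] \<in> lists (Lft ` A) \<longleftrightarrow> w \<in> lists (Lft ` A) \<and> a \<in> Lft ` A" for w a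
    by auto
  have K_snoc: "w @ [a] \<in> K \<longleftrightarrow> (w \<in> lists (Lft ` A) \<and> a = Mark False) \<or> (w \<in> K \<and> a \<in> Rgt ` A)" for w a
  proof
    assume "w @ [a] \<in> K"
    then obtain u v where uv: "u \<in> lists A" "v \<in> lists A" "w @ [a] = enc False u v"
      by (auto simp: K_def enc_rel_def)
    show "(w \<in> lists (Lft ` A) \<and> a = Mark False) \<or> (w \<in> K \<and> a \<in> Rgt ` A)"
    proof (cases v)
      case Nil
      then show ?thesis using uv by (auto simp: enc_def)
    next
      case (Cons b v')
      then have "w = enc False u v'" "a = Rgt b" using uv(3) by (simp_all add: enc_def)
      then show ?thesis using uv Cons by (auto simp: K_def)
    qed
  next
    assume "(w \<in> lists (Lft ` A) \<and> a = Mark False) \<or> (w \<in> K \<and> a \<in> Rgt ` A)"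
    then show "w @ [a] \<in> K"
    proof (elim disjE conjE)
      assume "w \<in> lists (Lft ` A)" "a = Mark False"
      then obtain u where "u \<in> lists A" "w = map Lft u" by (auto simp: lists_image)
      then have "w @ [a] = enc False u []" using \<open>a = Mark False\<close> by (simp add: enc_def)
      then show ?thesis using \<open>u \<in> lists A\<close> by (simp add: K_def)
    next
      assume "w \<in> K" "a \<in> Rgt ` A"
      then obtain u v b where "u \<in> lists A" "v \<in> lists A" "w = enc False u v" "b \<in> A" "a = Rgt b"
        by (auto simp: K_def enc_rel_def)
      moreover from this have "w @ [a] = enc False u (b # v)" by (simp add: enc_def)
      ultimately show ?thesis by (simp add: K_def)
    qed
  qed
  have "lang_in C ?L" using L finite_letters_over[OF A] by (rule lang_in_inverse_hom)
  \<comment> \<open>The two bits of the state say that no separator has been read, or exactly one at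
    a correct place; by \<open>K_snoc\<close> and \<open>Lft_snoc\<close> both can be updated letter
    by letter.\<close>
  then have "lang_in C {w \<in> ?L. w \<in> lists ?A \<and> w \<in> K}"
    by (rule lang_in_Int_regular[where f = "\<lambda>w. (w \<in> lists (Lft ` A), w \<in> K)"])
      (use finite_letters_over[OF A] in \<open>auto simp: Lft_snoc K_snoc simp del: append_in_lists_conv\<close>)
  moreover have "{w \<in> ?L. w \<in> lists ?A \<and> w \<in> K} = enc_rel False ?P"
    by (auto simp: K_def enc_rel_def set_enc letters_over_def)
  ultimately show ?thesis by (simp add: rel_in_def)
qed

text \<open>Sending the separator to \<open>enc b s s\<close> inserts the suffix \<open>s\<close> of
  both components, since their ends meet at the separator.\<close>

lemma rel_in_inverse_image:
  assumes "rel_in C P" "finite A"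
  shows "rel_in C {(u, v). u \<in> lists A \<and> v \<in> lists A \<and> (hom_ext f u @ s, hom_ext f v @ s) \<in> P}"
proof -
  let ?h = "case_letter (map Lft \<circ> f) (map Rgt \<circ> rev \<circ> f) (\<lambda>b. enc b s s)"
  have "hom_ext ?h (enc b u v) = enc b (hom_ext f u @ s) (hom_ext f v @ s)" for b u v
    by (simp add: enc_append) (simp add: enc_def hom_ext_map map_hom_ext rev_hom_ext comp_def)
  then show ?thesis
    using rel_in_inverse_hom[of "enc_rel False P" A ?h] assms by (simp add: rel_in_def)
qed

text \<open>Avoiding a factor is a regular condition: the state records whether
  \<open>\<beta>\<close> has occurred and which prefixes of \<open>\<beta>\<close> are suffixes of
  the word read so far.\<close>

lemma lang_in_avoiding:
  assumes L: "lang_in C L"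
  shows "lang_in C {w \<in> L. \<not> sublist \<beta> w}"
proof -
  obtain U where U: "finite U" "L \<subseteq> lists U" using lang_in_alphabet[OF L] .
  define f where "f w = (sublist \<beta> w, {k. k \<le> length \<beta> \<and> suffix (take k \<beta>) w})" for w
  have sublist_snoc: "sublist \<beta> (w @ [a]) \<longleftrightarrow> sublist \<beta> w \<or> suffix \<beta> (w @ [a])" for w a
  proof
    assume "sublist \<beta> (w @ [a])"
    then obtain x y where xy: "w @ [a] = x @ \<beta> @ y" by (auto simp: sublist_def)
    show "sublist \<beta> w \<or> suffix \<beta> (w @ [a])"
    proof (cases y rule: rev_cases)
      case Nil
      then show ?thesis using xy by (auto simp: suffix_def)
    next
      case (snoc y' b)
      then have "w = x @ \<beta> @ y'" using xy by simp
      then show ?thesis by (auto simp: sublist_def)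
    qed
  next
    assume "sublist \<beta> w \<or> suffix \<beta> (w @ [a])"
    then show "sublist \<beta> (w @ [a])"
    proof
      assume "sublist \<beta> w"
      then obtain x y where "w = x @ \<beta> @ y" by (auto simp: sublist_def)
      then have "w @ [a] = x @ \<beta> @ (y @ [a])" by simp
      then show ?thesis unfolding sublist_def by blast
    qed (rule suffix_imp_sublist)
  qed
  have suffix_snoc: "suffix (take k \<beta>) (w @ [a]) \<longleftrightarrow>
      k = 0 \<or> (suffix (take (k - 1) \<beta>) w \<and> \<beta> ! (k - 1) = a)" if "k \<le> length \<beta>" for k w a
    using that by (cases k) (auto simp: take_Suc_conv_app_nth)
  have step: "f (u @ [a]) = f (v @ [a])" if uv: "f u = f v" for u v a
  proof -
    have "suffix (take k \<beta>) (u @ [a]) \<longleftrightarrow> suffix (take k \<beta>) (v @ [a])" if k: "k \<le> length \<beta>" for k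
    proof -
      have "k - 1 \<in> {k. k \<le> length \<beta> \<and> suffix (take k \<beta>) u} \<longleftrightarrow>
            k - 1 \<in> {k. k \<le> length \<beta> \<and> suffix (take k \<beta>) v}"
        using uv by (simp add: f_def)
      then show ?thesis using k suffix_snoc[OF k] by auto
    qed
    moreover from this[of "length \<beta>"] have "sublist \<beta> (u @ [a]) \<longleftrightarrow> sublist \<beta> (v @ [a])"
      using uv by (simp add: f_def sublist_snoc)
    ultimately show ?thesis by (auto simp: f_def)
  qed
  have "range f \<subseteq> UNIV \<times> Pow {..length \<beta>}" by (auto simp: f_def)
  then have "finite (f ` lists U)"
    by (meson finite_Pow_iff finite_SigmaI finite_UNIV finite_atMost finite_subset image_mono subset_UNIV)
  then have "lang_in C {w \<in> L. w \<in> lists U \<and> w \<in> {w. \<not> sublist \<beta> w}}"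
    by (rule lang_in_Int_regular[where f = f, OF L U(1) _ step]) (auto simp: f_def)
  moreover have "{w \<in> L. w \<in> lists U \<and> w \<in> {w. \<not> sublist \<beta> w}} = {w \<in> L. \<not> sublist \<beta> w}"
    using U(2) by auto
  ultimately show ?thesis by simp
qed

text \<open>An occurrence of \<open>map Lft \<alpha>\<close> cannot contain the separator. It cannot
  lie behind it either, because all letters there are tagged \<open>Rgt\<close> and \<alpha> is
  nonempty.\<close>

lemma sublist_map_Lft_enc:
  assumes "\<alpha> \<noteq> []"
  shows "sublist (map Lft \<alpha>) (enc b u v) \<longleftrightarrow> sublist \<alpha> u"
proof
  assume "sublist \<alpha> u"
  then obtain x y where "u = x @ \<alpha> @ y" by (auto simp: sublist_def)
  then have "enc b u v = map Lft x @ map Lft \<alpha> @ (map Lft y @ Mark b # map Rgt (rev v))"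
    by (simp add: enc_def)
  then show "sublist (map Lft \<alpha>) (enc b u v)" unfolding sublist_def by blast
next
  assume "sublist (map Lft \<alpha>) (enc b u v)"
  then obtain x y where xy: "x @ map Lft \<alpha> @ y = enc b u v" by (auto simp: sublist_def)
  have "Mark b \<in> set (x @ map Lft \<alpha> @ y)" unfolding xy by (simp add: enc_def)
  then consider "Mark b \<in> set x" | "Mark b \<in> set y" by auto
  then show "sublist \<alpha> u"
  proof cases
    case 1
    then obtain x1 x2 where "x = x1 @ Mark b # x2" by (metis in_set_conv_decomp)
    then have "x1 @ Mark b # (x2 @ map Lft \<alpha> @ y) = enc b u v" using xy by simp
    then have "x2 @ map Lft \<alpha> @ y = map Rgt (rev v)" using append_Mark_eq_enc_iff by blast
    then have "set (map Lft \<alpha>) \<subseteq> set (map Rgt (rev v))" by (metis Un_iff set_append subsetI)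
    then show ?thesis using assms by (cases \<alpha>) auto
  next
    case 2
    then obtain y1 y2 where "y = y1 @ Mark b # y2" by (metis in_set_conv_decomp)
    then have "(x @ map Lft \<alpha> @ y1) @ Mark b # y2 = enc b u v" using xy by simp
    then have "x @ map Lft \<alpha> @ y1 = map Lft u" using append_Mark_eq_enc_iff by blast
    then obtain u1 u2 u3 where "u = u1 @ u2 @ u3" "map Lft \<alpha> = map Lft u2"
      by (metis map_eq_append_conv)
    then show ?thesis by (auto simp: sublist_def)
  qed
qed

text \<open>Meant for diagonal relations, where a test of the left component settles both.\<close>

lemma rel_in_avoiding:
  assumes "rel_in C P" "\<alpha> \<noteq> []"
  shows "rel_in C {(u, v). (u, v) \<in> P \<and> \<not> sublist \<alpha> u}"
proof -
  have "enc_rel False {(u, v). (u, v) \<in> P \<and> \<not> sublist \<alpha> u} =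
      {w \<in> enc_rel False P. \<not> sublist (map Lft \<alpha>) w}"
    using assms(2) by (auto simp: enc_rel_def sublist_map_Lft_enc)
  then show ?thesis using lang_in_avoiding assms(1) unfolding rel_in_def by metis
qed

end

section \<open>Stars and products of relations by monadic rewriting\<close>

lemma enc_rel_subset_lists:
  "P \<subseteq> lists A \<times> lists A \<Longrightarrow> enc_rel b P \<subseteq> lists (letters_over A)"
proof
  fix w assume P: "P \<subseteq> lists A \<times> lists A" and "w \<in> enc_rel b P"
  then obtain u v where "(u, v) \<in> P" "w = enc b u v" by (auto simp: enc_rel_def)
  then show "w \<in> lists (letters_over A)" using P by (metis enc_in_lists SigmaD1 SigmaD2 subsetD)
qed

text \<open>The submonoid generated by \<open>D\<close> in the direct product of two free monoids.
  Factors are added at the right end because this end is next to the separator in an encoded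
  pair.\<close>

inductive_set rel_star :: "('a list \<times> 'a list) set \<Rightarrow> ('a list \<times> 'a list) set" for D where
  Nil: "([], []) \<in> rel_star D"
| snoc: "(u, v) \<in> rel_star D \<Longrightarrow> (a, b) \<in> D \<Longrightarrow> (u @ a, v @ b) \<in> rel_star D"

definition rel_append ::
    "('a list \<times> 'a list) set \<Rightarrow> ('a list \<times> 'a list) set \<Rightarrow> ('a list \<times> 'a list) set" where
  "rel_append P Q = {(p @ q, p' @ q') | p p' q q'. (p, p') \<in> P \<and> (q, q') \<in> Q}"

lemma rel_star_in_lists:
  assumes "D \<subseteq> lists A \<times> lists A" "(u, v) \<in> rel_star D"
  shows "u \<in> lists A \<and> v \<in> lists A"
  using assms(2,1) by (induction rule: rel_star.induct) auto

text \<open>Applying \<open>concat\<close> to both components is a homomorphism, so it commutes with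
  generating a submonoid.\<close>

lemma rel_star_concat:
  "rel_star ((\<lambda>(u, v). (concat u, concat v)) ` D) = (\<lambda>(u, v). (concat u, concat v)) ` rel_star D"
    (is "rel_star (?f ` D) = _")
proof (intro equalityI subsetI)
  have "(u, v) \<in> ?f ` rel_star D" if "(u, v) \<in> rel_star (?f ` D)" for u v
    using that
  proof (induction rule: rel_star.induct)
    case Nil
    have "([], []) = ?f ([], [])" by simp
    then show ?case using rel_star.Nil by blast
  next
    case (snoc u v a b)
    then obtain x y x' y' where *: "(x, y) \<in> rel_star D" "u = concat x" "v = concat y"
      "(x', y') \<in> D" "a = concat x'" "b = concat y'" by auto
    then have "(u @ a, v @ b) = ?f (x @ x', y @ y')" by simp
    moreover have "(x @ x', y @ y') \<in> rel_star D" using *(1,4) by (rule rel_star.snoc)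
    ultimately show ?case by blast
  qed
  then show "p \<in> ?f ` rel_star D" if "p \<in> rel_star (?f ` D)" for p using that by (cases p) blast
  have "(concat u, concat v) \<in> rel_star (?f ` D)" if "(u, v) \<in> rel_star D" for u v
    using that
  proof (induction rule: rel_star.induct)
    case (snoc u v a b)
    then have "(concat a, concat b) \<in> ?f ` D" by force
    with snoc.IH show ?case by (simp add: rel_star.snoc)
  qed (simp add: rel_star.Nil)
  then show "p \<in> rel_star (?f ` D)" if "p \<in> ?f ` rel_star D" for p using that by auto
qed

lemma rel_star_letters: "rel_star ((\<lambda>a. ([a], [a])) ` A) = Id_on (lists A)"
proof (intro equalityI subsetI)
  have "u \<in> lists A \<and> u = v" if "(u, v) \<in> rel_star ((\<lambda>a. ([a], [a])) ` A)" for u v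
    using that by (induction rule: rel_star.induct) auto
  then show "p \<in> Id_on (lists A)" if "p \<in> rel_star ((\<lambda>a. ([a], [a])) ` A)" for p
    using that by (cases p) auto
next
  fix p assume "p \<in> Id_on (lists A)"
  then obtain u where "u \<in> lists A" "p = (u, u)" by auto
  moreover have "(u, u) \<in> rel_star ((\<lambda>a. ([a], [a])) ` A)" if "u \<in> lists A" for u
    using that
  proof (induction u rule: rev_induct)
    case (snoc a u)
    then have "(u, u) \<in> rel_star ((\<lambda>a. ([a], [a])) ` A)" "([a], [a]) \<in> (\<lambda>a. ([a], [a])) ` A" by auto
    then show ?case by (rule rel_star.snoc)
  qed (rule rel_star.Nil)
  ultimately show "p \<in> rel_star ((\<lambda>a. ([a], [a])) ` A)" by simp
qed

context super_afl
begin

text \<open>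
  Rewriting \<open>d\<^sub>1 # d\<^sub>2\<^sup>r\<^sup>e\<^sup>v\<close> for \<open>(d\<^sub>1, d\<^sub>2) \<in> D\<close> to the nonterminal peels off one factor from the inside,
  the terminal separator disappears in the innermost step, for a pair in \<open>Q\<close>, and what is left in
  the end is a pair in \<open>P\<close>.
\<close>

lemma rel_in_append_star_append:
  assumes "rel_in C P" "rel_in C D" "rel_in C Q"
  shows "rel_in C (rel_append P (rel_append (rel_star D) Q))" (is "rel_in C ?S")
proof -
  obtain A where A: "finite A" "P \<subseteq> lists A \<times> lists A" "D \<subseteq> lists A \<times> lists A" "Q \<subseteq> lists A \<times> lists A"
  proof -
    obtain A1 A2 A3 where "finite A1" "P \<subseteq> lists A1 \<times> lists A1" "finite A2" "D \<subseteq> lists A2 \<times> lists A2"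
      "finite A3" "Q \<subseteq> lists A3 \<times> lists A3"
      using rel_in_alphabet assms by metis
    moreover have "lists A1 \<subseteq> lists (A1 \<union> A2 \<union> A3)" "lists A2 \<subseteq> lists (A1 \<union> A2 \<union> A3)"
      "lists A3 \<subseteq> lists (A1 \<union> A2 \<union> A3)" by auto
    ultimately show thesis using that[of "A1 \<union> A2 \<union> A3"] by blast
  qed
  have PA: "u \<in> lists A" "v \<in> lists A" if "(u, v) \<in> P" for u v using A(2) that by blast+
  have DA: "u \<in> lists A" "v \<in> lists A" if "(u, v) \<in> D" for u v using A(3) that by blast+
  have QA: "u \<in> lists A" "v \<in> lists A" if "(u, v) \<in> Q" for u v using A(4) that by blast+
  define lhs where "lhs = enc_rel True D \<union> enc_rel False Q"
  define R where "R = lhs \<times> {[Mark True :: 'a letter]}"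
  let ?A = "letters_over A"
  let ?step = "rewrite_step ?A R"
  have lhs_subset: "lhs \<subseteq> lists ?A"
    unfolding lhs_def by (intro Un_least enc_rel_subset_lists A(3,4))
  have "monadic ?A R"
    unfolding monadic_def
  proof (intro conjI)
    show "R \<subseteq> lists ?A \<times> lists ?A" using lhs_subset by (auto simp: R_def letters_over_def)
    show "\<forall>(u, v)\<in>R. length v \<le> length u \<and> v \<in> letters_or_empty ?A"
      by (auto simp: R_def lhs_def enc_rel_def enc_def letters_or_empty_def letters_over_def)
  qed
  moreover have "lang_in C {l. (l, r) \<in> R}" for r
  proof -
    have "lang_in C lhs"
      unfolding lhs_def using assms enc_rel_change_mark
      by (intro lang_in_Un) (auto simp: rel_in_def)
    moreover have "{l. (l, r) \<in> R} = (if r = [Mark True] then lhs else {})"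
      by (auto simp: R_def)
    ultimately show ?thesis by (simp add: lang_in_empty)
  qed
  moreover have "lang_in C (enc_rel True P)"
    using assms(1) enc_rel_change_mark unfolding rel_in_def by blast
  moreover have "enc_rel True P \<subseteq> lists ?A"
    by (intro enc_rel_subset_lists A(2))
  ultimately have "lang_in C (ancestors ?A R (enc_rel True P))"
    using finite_letters_over[OF A(1)] by (intro lang_in_ancestors)
  \<comment> \<open>Ancestors that still contain the nonterminal lack their innermost pair from
    \<open>Q\<close>; only words without it are kept.\<close>
  then have "lang_in C (ancestors ?A R (enc_rel True P) \<inter> lists (?A - {Mark True}))"
    using finite_letters_over[OF A(1)] by (intro lang_in_lists_Int) auto
  moreover have "ancestors ?A R (enc_rel True P) \<inter> lists (?A - {Mark True}) = enc_rel False ?S"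
  proof (intro equalityI subsetI)
    fix w assume w: "w \<in> ancestors ?A R (enc_rel True P) \<inter> lists (?A - {Mark True})"
    then obtain p p' where p: "(p, p') \<in> P" "(w, enc True p p') \<in> ?step\<^sup>*"
      by (auto simp: ancestors_def enc_rel_def)
    \<comment> \<open>Induction backwards along the derivation. The nonterminal is the only
      right-hand side, so a word that already has the terminal separator results from no step;
      before that, each step inserts a pair from \<open>D\<close> or finally one from
      \<open>Q\<close> at the separator.\<close>
    from p(2) have "(\<exists>d d'. (d, d') \<in> rel_star D \<and> w = enc True (p @ d) (p' @ d')) \<or> w \<in> enc_rel False ?S"
    proof (induction rule: converse_rtrancl_induct)
      case base
      show ?case using rel_star.Nil by force
    next
      case (step y z)
      then obtain a b l where yz: "y = a @ l @ b" "z = a @ Mark True # b" "l \<in> lhs"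
        by (auto simp: rewrite_step_def R_def)
      have "z \<notin> enc_rel False ?S"
        using yz(2) append_Mark_eq_enc_iff[of a True b False] by (auto simp: enc_rel_def)
      then obtain d d' where d: "(d, d') \<in> rel_star D" "z = enc True (p @ d) (p' @ d')"
        using step.IH by blast
      then have ab: "a = map Lft (p @ d)" "b = map Rgt (rev (p' @ d'))"
        using yz(2) append_Mark_eq_enc_iff by metis+
      from yz(3) consider e e' where "(e, e') \<in> D" "l = enc True e e'"
        | e e' where "(e, e') \<in> Q" "l = enc False e e'"
        by (auto simp: lhs_def enc_rel_def)
      then show ?case
      proof cases
        case 1
        then have "y = enc True (p @ (d @ e)) (p' @ (d' @ e'))" unfolding yz(1) ab by (simp add: enc_def)
        moreover have "(d @ e, d' @ e') \<in> rel_star D" using d(1) 1(1) by (rule rel_star.snoc)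
        ultimately show ?thesis by blast
      next
        case 2
        then have "y = enc False (p @ (d @ e)) (p' @ (d' @ e'))" unfolding yz(1) ab by (simp add: enc_def)
        moreover have "(p @ (d @ e), p' @ (d' @ e')) \<in> ?S"
          using d(1) 2(1) p(1) unfolding rel_append_def by blast
        ultimately show ?thesis by simp
      qed
    qed
    moreover have "Mark True \<notin> set w" using w by auto
    ultimately show "w \<in> enc_rel False ?S" by (auto simp: set_enc)
  next
    fix w assume "w \<in> enc_rel False ?S"
    then obtain p p' d d' q q' where
      *: "(p, p') \<in> P" "(d, d') \<in> rel_star D" "(q, q') \<in> Q" "w = enc False (p @ d @ q) (p' @ d' @ q')"
      by (auto simp: enc_rel_def rel_append_def)
    have step: "(enc b (x @ e) (y @ e'), enc True x y) \<in> ?step"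
      if "enc b e e' \<in> lhs" "x \<in> lists A" "y \<in> lists A" for b x y e e'
    proof -
      have "map Lft x \<in> lists ?A" "map Rgt (rev y) \<in> lists ?A"
        using that(2,3) by (auto simp: letters_over_def)
      moreover have "enc True x y = map Lft x @ [Mark True] @ map Rgt (rev y)" by (simp add: enc_def)
      moreover have "(enc b e e', [Mark True]) \<in> R" using that(1) by (simp add: R_def)
      ultimately show ?thesis unfolding rewrite_step_def enc_append by blast
    qed
    have pA: "p \<in> lists A" "p' \<in> lists A" using PA *(1) by auto
    have "(enc True (p @ d) (p' @ d'), enc True p p') \<in> ?step\<^sup>*"
      using *(2)
    proof (induction rule: rel_star.induct)
      case (snoc u v a b)
      have "enc True a b \<in> lhs" using snoc.hyps(2) by (simp add: lhs_def)
      then have "(enc True ((p @ u) @ a) ((p' @ v) @ b), enc True (p @ u) (p' @ v)) \<in> ?step"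
        using rel_star_in_lists[OF A(3) snoc.hyps(1)] pA by (intro step) auto
      then show ?case using snoc.IH by (simp add: converse_rtrancl_into_rtrancl)
    qed simp
    moreover have "(w, enc True (p @ d) (p' @ d')) \<in> ?step"
    proof -
      have "enc False q q' \<in> lhs" using *(3) by (simp add: lhs_def)
      then have "(enc False ((p @ d) @ q) ((p' @ d') @ q'), enc True (p @ d) (p' @ d')) \<in> ?step"
        using rel_star_in_lists[OF A(3) *(2)] pA by (intro step) auto
      then show ?thesis using *(4) by simp
    qed
    ultimately have "(w, enc True p p') \<in> ?step\<^sup>*" by (meson converse_rtrancl_into_rtrancl)
    moreover have "w \<in> lists ?A"
      unfolding *(4) enc_in_lists using pA rel_star_in_lists[OF A(3) *(2)] QA[OF *(3)] by simp
    moreover have "w \<in> lists (?A - {Mark True})"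
    proof -
      have "Mark True \<notin> set w" by (auto simp: *(4) set_enc)
      with \<open>w \<in> lists ?A\<close> show ?thesis by auto
    qed
    moreover have "enc True p p' \<in> enc_rel True P" using *(1) by simp
    ultimately show "w \<in> ancestors ?A R (enc_rel True P) \<inter> lists (?A - {Mark True})"
      unfolding ancestors_def by blast
  qed
  ultimately show ?thesis by (simp add: rel_in_def)
qed

lemma rel_in_star:
  assumes "rel_in C D"
  shows "rel_in C (rel_star D)"
proof -
  have "rel_append {([], [])} (rel_append (rel_star D) {([], [])}) = rel_star D"
    by (auto simp: rel_append_def)
  then show ?thesis
    using rel_in_append_star_append[OF rel_in_finite assms rel_in_finite, of "{([], [])}" "{([], [])}"]
    by simp
qed

lemma rel_in_Id_on_lists: "finite A \<Longrightarrow> rel_in C (Id_on (lists A))"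
  using rel_in_star[OF rel_in_finite, of "(\<lambda>a. ([a], [a])) ` A"] by (simp add: rel_star_letters)

end

section \<open>Word problems\<close>

definition word_problem_rel :: "'g set \<Rightarrow> ('g list \<Rightarrow> 'n) \<Rightarrow> ('g list \<times> 'g list) set" where
  "word_problem_rel G c = {(u, v). u \<in> lists G \<and> v \<in> lists G \<and> c u = c v}"

lemma word_problem_iff:
  assumes "h \<notin> B" "u \<in> lists B" "v \<in> lists B"
  shows "u @ [h] @ rev v \<in> word_problem B \<pi> h \<longleftrightarrow> \<pi> u = \<pi> v"
proof
  assume "u @ [h] @ rev v \<in> word_problem B \<pi> h"
  then obtain u' v' where *: "u @ h # rev v = u' @ h # rev v'" "u' \<in> lists B" "v' \<in> lists B" "\<pi> u' = \<pi> v'"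
    by (auto simp: word_problem_def)
  have "h \<notin> set u" "h \<notin> set (rev v)" "h \<notin> set u'" using assms * by auto
  then have "u = u' \<and> rev v = rev v'"
    using append_Cons_eq_iff[of h u "rev v" u' "rev v'"] *(1) by simp
  then show "\<pi> u = \<pi> v" using *(4) by simp
qed (use assms in \<open>auto simp: word_problem_def\<close>)

context afl
begin

text \<open>Change of generators: each \<open>g\<close> in \<open>G\<close> is expressed by a word
  \<open>f g\<close> over \<open>B\<close>, and the given word problem is pulled back along a
  homomorphism that also drops the side tags and sends the separator to \<open>h\<close>.\<close>

lemma rel_in_word_problem:
  assumes wp: "has_word_problem_in N C" and gen: "generates_via N G c" and G: "finite G"
  shows "rel_in C (word_problem_rel G c)"
proof -
  obtain B \<pi> h where B: "h \<notin> B" "generates_via N B \<pi>" "word_problem B \<pi> h \<in> C"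
    using wp unfolding has_word_problem_in_def by blast
  have "\<exists>w. w \<in> lists B \<and> \<pi> w = c [g]" if "g \<in> G" for g
  proof -
    have "c [g] \<in> carrier N" using gen that unfolding generates_via_def by auto
    then show ?thesis using B(2) unfolding generates_via_def by (metis imageE)
  qed
  then obtain f where f: "\<And>g. g \<in> G \<Longrightarrow> f g \<in> lists B \<and> \<pi> (f g) = c [g]" by metis
  have F: "hom_ext f u \<in> lists B" if "u \<in> lists G" for u
    using that f by (intro hom_ext_in_lists[of u G]) auto
  have c_Cons: "c (g # u) = c [g] \<otimes>\<^bsub>N\<^esub> c u" if "g \<in> G" "u \<in> lists G" for g u
    using gen that hom_mult[of c "free_monoid G" N "[g]" u]
    by (simp add: generates_via_def free_monoid_def)
  have \<pi>_append: "\<pi> (u @ v) = \<pi> u \<otimes>\<^bsub>N\<^esub> \<pi> v" if "u \<in> lists B" "v \<in> lists B" for u v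
    using B(2) that hom_mult[of \<pi> "free_monoid B" N u v]
    by (simp add: generates_via_def free_monoid_def)
  have eq: "\<pi> (hom_ext f u) = c u" if "u \<in> lists G" for u
    using that
  proof (induction u)
    case Nil
    then show ?case using gen B(2) by (simp add: generates_via_def)
  next
    case (Cons g u)
    then have gu: "g \<in> G" "u \<in> lists G" by auto
    have "\<pi> (hom_ext f (g # u)) = \<pi> (f g) \<otimes>\<^bsub>N\<^esub> \<pi> (hom_ext f u)"
      unfolding hom_ext_Cons using f[OF gu(1)] F[OF gu(2)] by (intro \<pi>_append) auto
    then show ?case using Cons.IH gu(2) f[OF gu(1)] c_Cons[OF gu] by simp
  qed
  let ?h = "case_letter f (rev \<circ> f) (\<lambda>b. [h])"
  have enc: "hom_ext ?h (enc False u v) = hom_ext f u @ [h] @ rev (hom_ext f v)" for u v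
    by (simp add: enc_def hom_ext_map rev_hom_ext comp_def)
  have key: "hom_ext ?h (enc False u v) \<in> word_problem B \<pi> h \<longleftrightarrow> c u = c v"
    if "u \<in> lists G" "v \<in> lists G" for u v
    unfolding enc word_problem_iff[OF B(1) F[OF that(1)] F[OF that(2)]] using eq that by simp
  have "lang_in C (word_problem B \<pi> h)" using B(3) lang_in_nat by simp
  then have "rel_in C {(u, v). u \<in> lists G \<and> v \<in> lists G \<and> hom_ext ?h (enc False u v) \<in> word_problem B \<pi> h}"
    using G by (rule rel_in_inverse_hom)
  moreover have "{(u, v). u \<in> lists G \<and> v \<in> lists G \<and> hom_ext ?h (enc False u v) \<in> word_problem B \<pi> h} =
      word_problem_rel G c"
    unfolding word_problem_rel_def using key by blast
  ultimately show ?thesis by simp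
qed

text \<open>The generators are renamed to numbers, and a fresh number \<open>h\<close> serves as
  separator. A letter homomorphism that forgets the side tags then yields the word problem.\<close>

lemma has_word_problem_in_if_rel_in:
  assumes wp: "rel_in C (word_problem_rel G c)" and gen: "generates_via N G c" and G: "finite G"
  shows "has_word_problem_in N C"
proof -
  obtain e :: "'a \<Rightarrow> nat" and d where ed: "\<And>x. x \<in> G \<Longrightarrow> d (e x) = x"
    using finite_nat_encoding[OF G] by metis
  have de: "map d (map e w) = w" if "w \<in> lists G" for w
    using that ed by (rule map_inverse_on)
  have decode: "\<exists>u\<in>lists G. w = map e u" if "w \<in> lists (e ` G)" for w
    using that by (auto simp: lists_image)
  have dG: "map d w \<in> lists G" if "w \<in> lists (e ` G)" for w using decode[OF that] de by metis
  obtain h where h: "h \<notin> e ` G" using G by (metis ex_new_if_finite finite_imageI infinite_UNIV_nat)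
  let ?\<pi> = "c \<circ> map d"
  let ?f = "case_letter e e (\<lambda>b. h)"
  have "generates_via N (e ` G) ?\<pi>"
    unfolding generates_via_def
  proof (intro conjI)
    show "?\<pi> \<in> hom (free_monoid (e ` G)) N"
    proof (rule homI)
      fix x assume "x \<in> carrier (free_monoid (e ` G))"
      then have "map d x \<in> lists G" using dG by (simp add: free_monoid_def)
      then show "?\<pi> x \<in> carrier N" using gen by (auto simp: generates_via_def)
    next
      fix x y assume "x \<in> carrier (free_monoid (e ` G))" "y \<in> carrier (free_monoid (e ` G))"
      then have "map d x \<in> lists G" "map d y \<in> lists G" using dG by (simp_all add: free_monoid_def)
      then show "?\<pi> (x \<otimes>\<^bsub>free_monoid (e ` G)\<^esub> y) = ?\<pi> x \<otimes>\<^bsub>N\<^esub> ?\<pi> y"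
        using gen hom_mult[of c "free_monoid G" N "map d x" "map d y"]
        by (simp add: generates_via_def free_monoid_def)
    qed
    show "?\<pi> [] = \<one>\<^bsub>N\<^esub>" using gen by (simp add: generates_via_def)
    have "map d ` lists (e ` G) = lists G" using ed by (simp add: lists_image[symmetric] image_image)
    then show "?\<pi> ` lists (e ` G) = carrier N" using gen unfolding generates_via_def image_comp[symmetric] by simp
  qed
  moreover have "word_problem (e ` G) ?\<pi> h \<in> C"
  proof -
    have "word_problem (e ` G) ?\<pi> h = map ?f ` enc_rel False (word_problem_rel G c)"
    proof (intro equalityI subsetI)
      fix w assume "w \<in> word_problem (e ` G) ?\<pi> h"
      then obtain u v where uv: "w = u @ [h] @ rev v" "u \<in> lists (e ` G)" "v \<in> lists (e ` G)"
        "c (map d u) = c (map d v)" by (auto simp: word_problem_def)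
      obtain x y where xy: "x \<in> lists G" "y \<in> lists G" "u = map e x" "v = map e y"
        using decode uv(2,3) by metis
      then have "(x, y) \<in> word_problem_rel G c"
        using uv(4) de by (simp add: word_problem_rel_def del: map_map)
      moreover have "w = map ?f (enc False x y)" using uv(1) xy by (simp add: enc_def rev_map)
      ultimately show "w \<in> map ?f ` enc_rel False (word_problem_rel G c)" by (simp add: image_iff) force
    next
      fix w assume "w \<in> map ?f ` enc_rel False (word_problem_rel G c)"
      then obtain x y where xy: "x \<in> lists G" "y \<in> lists G" "c x = c y" "w = map ?f (enc False x y)"
        by (auto simp: enc_rel_def word_problem_rel_def)
      have "w = map e x @ [h] @ rev (map e y)" unfolding xy(4) by (simp add: enc_def rev_map)
      moreover have "map e x \<in> lists (e ` G)" "map e y \<in> lists (e ` G)" using xy(1,2) by auto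
      moreover have "?\<pi> (map e x) = ?\<pi> (map e y)" using xy de by (simp del: map_map)
      ultimately show "w \<in> word_problem (e ` G) ?\<pi> h" unfolding word_problem_def by blast
    qed
    then show ?thesis using lang_in_map[of _ ?f] wp lang_in_nat unfolding rel_in_def by metis
  qed
  ultimately show ?thesis using G h unfolding has_word_problem_in_def by blast
qed

lemma has_word_problem_in_iff_rel_in:
  "generates_via N G c \<Longrightarrow> finite G \<Longrightarrow> has_word_problem_in N C \<longleftrightarrow> rel_in C (word_problem_rel G c)"
  using rel_in_word_problem has_word_problem_in_if_rel_in by blast

end

section \<open>Presented monoids\<close>

lemma pres_cong_converse: "(pres_cong A R)\<inverse> = pres_cong A R"
proof -
  have "((rewrite_step A R \<union> (rewrite_step A R)\<inverse>)\<^sup>*)\<inverse> = (rewrite_step A R \<union> (rewrite_step A R)\<inverse>)\<^sup>*"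
    by (simp add: rtrancl_converse[symmetric] converse_Un Un_commute)
  then show ?thesis unfolding pres_cong_def by (simp add: converse_Int) blast
qed

locale presentation =
  fixes A :: "'a set" and R :: "('a list \<times> 'a list) set"
  assumes relations: "R \<subseteq> lists A \<times> lists A"
begin

abbreviation "cong \<equiv> pres_cong A R"

lemma cong_in_lists: "(u, v) \<in> cong \<Longrightarrow> u \<in> lists A \<and> v \<in> lists A"
  by (simp add: pres_cong_def)

lemma cong_refl: "w \<in> lists A \<Longrightarrow> (w, w) \<in> cong"
  by (simp add: pres_cong_def)

lemma cong_sym: "(u, v) \<in> cong \<Longrightarrow> (v, u) \<in> cong"
  using pres_cong_converse by blast

lemma cong_trans: "(u, v) \<in> cong \<Longrightarrow> (v, w) \<in> cong \<Longrightarrow> (u, w) \<in> cong"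
  unfolding pres_cong_def by (auto intro: rtrancl_trans)

lemma cong_step:
  assumes "(l, r) \<in> R \<union> R\<inverse>" "x \<in> lists A" "y \<in> lists A"
  shows "(x @ l @ y, x @ r @ y) \<in> cong"
proof -
  have "(x @ l @ y, x @ r @ y) \<in> rewrite_step A R \<union> (rewrite_step A R)\<inverse>"
    using assms unfolding rewrite_step_def by blast
  moreover have "l \<in> lists A" "r \<in> lists A" using assms(1) relations by blast+
  ultimately show ?thesis using assms(2,3) unfolding pres_cong_def by auto
qed

text \<open>The word \<open>u\<close> stays fixed while the derivation is extended; joining
  \<open>R\<close> and its converse treats both directions of a relation at once.\<close>

lemma cong_induct [consumes 1, case_names refl step]:
  assumes "(u, v) \<in> cong" and "P u"
    and step: "\<And>x y l r. P (x @ l @ y) \<Longrightarrow> (u, x @ l @ y) \<in> cong \<Longrightarrow> x \<in> lists A \<Longrightarrow> y \<in> lists A \<Longrightarrow>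
      (l, r) \<in> R \<union> R\<inverse> \<Longrightarrow> P (x @ r @ y)"
  shows "P v"
proof -
  have u: "u \<in> lists A" and "(u, v) \<in> (rewrite_step A R \<union> (rewrite_step A R)\<inverse>)\<^sup>*"
    using assms(1) by (auto simp: pres_cong_def)
  from this(2) have "P v \<and> (u, v) \<in> cong"
  proof (induction rule: rtrancl_induct)
    case base
    then show ?case using \<open>P u\<close> u cong_refl by blast
  next
    case (step w z)
    then obtain x y l r where *: "w = x @ l @ y" "z = x @ r @ y" "(l, r) \<in> R \<union> R\<inverse>" "x \<in> lists A" "y \<in> lists A"
      unfolding rewrite_step_def by blast
    then show ?case using step.IH assms(3) cong_step cong_trans by metis
  qed
  then show ?thesis ..
qed

lemma cong_context:
  assumes "(u, v) \<in> cong" "x \<in> lists A" "y \<in> lists A"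
  shows "(x @ u @ y, x @ v @ y) \<in> cong"
  using assms(1)
proof (induction rule: cong_induct)
  case refl
  then show ?case using assms cong_in_lists by (intro cong_refl) auto
next
  case (step x' y' l r)
  have "((x @ x') @ l @ (y' @ y), (x @ x') @ r @ (y' @ y)) \<in> cong"
    using step assms by (intro cong_step) auto
  then show ?case using step.IH cong_trans by simp
qed

lemma cong_append:
  assumes "(u, v) \<in> cong" "(u', v') \<in> cong"
  shows "(u @ u', v @ v') \<in> cong"
proof (rule cong_trans)
  show "(u @ u', v @ u') \<in> cong"
    using cong_context[OF assms(1), of "[]" u'] cong_in_lists[OF assms(2)] by simp
  show "(v @ u', v @ v') \<in> cong"
    using cong_context[OF assms(2), of v "[]"] cong_in_lists[OF assms(1)] by simp
qed

lemma equiv_cong: "equiv (lists A) cong"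
proof (rule equivI)
  show "cong \<subseteq> lists A \<times> lists A" by (auto simp: pres_cong_def)
qed (auto intro!: refl_onI symI transI intro: cong_refl cong_sym cong_trans)

abbreviation "cls w \<equiv> cong `` {w}"

lemma cls_eq_iff: "u \<in> lists A \<Longrightarrow> v \<in> lists A \<Longrightarrow> cls u = cls v \<longleftrightarrow> (u, v) \<in> cong"
  by (rule eq_equiv_class_iff[OF equiv_cong])

lemma word_problem_rel_cls: "B \<subseteq> A \<Longrightarrow> word_problem_rel B cls = cong \<inter> lists B \<times> lists B"
  using cls_eq_iff lists_mono[of B A] unfolding word_problem_rel_def by blast

lemma mult_cls:
  assumes "u \<in> lists A" "v \<in> lists A"
  shows "cls u \<otimes>\<^bsub>presented_monoid A R\<^esub> cls v = cls (u @ v)"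
proof -
  have "cls (x @ y) = cls (u @ v)" if "x \<in> cls u" "y \<in> cls v" for x y
  proof -
    have "(u @ v, x @ y) \<in> cong" using that by (intro cong_append) auto
    then show ?thesis using cls_eq_iff cong_in_lists by metis
  qed
  then have "(\<Union>x\<in>cls u. \<Union>y\<in>cls v. cls (x @ y)) = (\<Union>x\<in>cls u. \<Union>y\<in>cls v. cls (u @ v))"
    by (intro SUP_cong refl)
  also have "\<dots> = cls (u @ v)"
  proof -
    have "cls u \<noteq> {}" "cls v \<noteq> {}" using assms cong_refl by blast+
    then show ?thesis by (simp only: UN_constant if_False)
  qed
  finally show ?thesis by (simp add: presented_monoid_def)
qed

lemma generates_presented_monoid: "generates_via (presented_monoid A R) A cls"
  unfolding generates_via_def
proof (intro conjI)
  show "cls \<in> hom (free_monoid A) (presented_monoid A R)"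
  proof (rule homI)
    fix x assume "x \<in> carrier (free_monoid A)"
    then show "cls x \<in> carrier (presented_monoid A R)"
      by (simp add: free_monoid_def presented_monoid_def quotientI)
  next
    fix x y assume "x \<in> carrier (free_monoid A)" "y \<in> carrier (free_monoid A)"
    then show "cls (x \<otimes>\<^bsub>free_monoid A\<^esub> y) = cls x \<otimes>\<^bsub>presented_monoid A R\<^esub> cls y"
      using mult_cls by (simp add: free_monoid_def)
  qed
qed (auto simp: presented_monoid_def quotient_def)

end

section \<open>Generated submonoids and free products with a free monoid\<close>

lemma generates_submonoid_generated:
  assumes gen: "generates_via N S c" and G: "G \<subseteq> S"
  shows "generates_via (submonoid_generated N ((\<lambda>\<gamma>. c [\<gamma>]) ` G)) G c"
proof -
  let ?X = "(\<lambda>\<gamma>. c [\<gamma>]) ` G"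
  have mult: "c (u @ v) = c u \<otimes>\<^bsub>N\<^esub> c v" if "u \<in> lists S" "v \<in> lists S" for u v
    using gen that hom_mult[of c "free_monoid S" N u v]
    by (simp add: generates_via_def free_monoid_def)
  have one: "c [] = \<one>\<^bsub>N\<^esub>" and carrier: "c ` lists S = carrier N"
    using gen by (simp_all add: generates_via_def)
  have GS: "u \<in> lists S" if "u \<in> lists G" for u using that G by (metis lists_mono subsetD)
  have "submonoid (c ` lists G) N"
  proof
    show "c ` lists G \<subseteq> carrier N" using carrier GS by blast
    show "\<one>\<^bsub>N\<^esub> \<in> c ` lists G" unfolding one[symmetric] by (rule imageI) simp
    fix x y assume "x \<in> c ` lists G" "y \<in> c ` lists G"
    then obtain u v where uv: "u \<in> lists G" "v \<in> lists G" "x = c u" "y = c v" by blast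
    then have "x \<otimes>\<^bsub>N\<^esub> y = c (u @ v)" using mult GS by simp
    moreover have "u @ v \<in> lists G" using uv by simp
    ultimately show "x \<otimes>\<^bsub>N\<^esub> y \<in> c ` lists G" by blast
  qed
  moreover have "?X \<subseteq> c ` lists G" by auto
  moreover have "c ` lists G \<subseteq> H" if H: "submonoid H N" "?X \<subseteq> H" for H
  proof -
    have "c u \<in> H" if "u \<in> lists G" for u
      using that
    proof (induction u)
      case Nil
      then show ?case using submonoid.one_closed[OF H(1)] one by simp
    next
      case (Cons g u)
      then have "g \<in> G" "u \<in> lists G" "c u \<in> H" by auto
      moreover have "c [g] \<in> H" using H(2) \<open>g \<in> G\<close> by blast
      moreover have "c (g # u) = c [g] \<otimes>\<^bsub>N\<^esub> c u"
        using mult[of "[g]" u] \<open>g \<in> G\<close> \<open>u \<in> lists G\<close> GS G by auto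
      ultimately show ?case using submonoid.m_closed[OF H(1)] by metis
    qed
    then show ?thesis by blast
  qed
  ultimately have carrier_eq: "\<Inter>{H. submonoid H N \<and> ?X \<subseteq> H} = c ` lists G"
    by (intro equalityI Inter_lower Inter_greatest) auto
  show ?thesis
    unfolding generates_via_def submonoid_generated_def carrier_eq
  proof (intro conjI)
    show "c \<in> hom (free_monoid G) (N\<lparr>carrier := c ` lists G\<rparr>)"
    proof (rule homI)
      fix x y assume "x \<in> carrier (free_monoid G)" "y \<in> carrier (free_monoid G)"
      then have "x \<in> lists S" "y \<in> lists S" using GS by (simp_all add: free_monoid_def)
      then show "c (x \<otimes>\<^bsub>free_monoid G\<^esub> y) = c x \<otimes>\<^bsub>N\<lparr>carrier := c ` lists G\<rparr>\<^esub> c y"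
        using mult by (simp add: free_monoid_def)
    qed (simp add: free_monoid_def)
  qed (simp_all add: one)
qed

text \<open>The letter \<open>t\<close> does not occur in \<open>w\<close>, so the marked occurrence
  of \<open>w\<close> lies entirely before or entirely after the marked occurrence of
  \<open>t\<close>.\<close>

lemma lists_subset_splits:
  assumes "x @ w @ y = g @ t # s" "w \<in> lists G" "t \<notin> G"
  shows "(\<exists>y'. g = x @ w @ y' \<and> y = y' @ t # s) \<or> (\<exists>x'. x = g @ t # x' \<and> s = x' @ w @ y)"
proof -
  have "t \<notin> set w" using assms by auto
  from assms(1) have "(x @ w) @ y = g @ t # s" by simp
  then consider us where "x @ w = g @ us" "us @ y = t # s" | us where "(x @ w) @ us = g" "y = us @ t # s"
    unfolding append_eq_append_conv2 by blast
  then show ?thesis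
  proof cases
    case 1
    from 1(1) consider vs where "x = g @ vs" "vs @ w = us" | vs where "x @ vs = g" "w = vs @ us"
      unfolding append_eq_append_conv2 by blast
    then show ?thesis
    proof cases
      case a: 1
      show ?thesis
      proof (cases vs)
        case Nil
        then show ?thesis using a 1(2) \<open>t \<notin> set w\<close> by (cases w) auto
      next
        case (Cons b vs')
        then show ?thesis using a 1(2) by auto
      qed
    next
      case 2
      then show ?thesis using 1(2) \<open>t \<notin> set w\<close> by (cases us) auto
    qed
  qed auto
qed

context presentation
begin

text \<open>
  If the relations only involve the letters in \<open>G\<close>, then the monoid is the free product of the
  submonoid generated by \<open>G\<close> and the free monoid on the other letters. The decomposition
  \<open>g\<^sub>0 t\<^sub>1 g\<^sub>1 \<dots> t\<^sub>n g\<^sub>n\<close> with \<open>t\<^sub>i \<notin> G\<close> is the normal form.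
\<close>

inductive free_product_cong :: "'a set \<Rightarrow> 'a list \<Rightarrow> 'a list \<Rightarrow> bool" for G where
  base: "g \<in> lists G \<Longrightarrow> g' \<in> lists G \<Longrightarrow> (g, g') \<in> cong \<Longrightarrow> free_product_cong G g g'"
| snoc: "free_product_cong G u v \<Longrightarrow> t \<in> A - G \<Longrightarrow> g \<in> lists G \<Longrightarrow> g' \<in> lists G \<Longrightarrow> (g, g') \<in> cong \<Longrightarrow>
    free_product_cong G (u @ t # g) (v @ t # g')"

lemma free_product_cong_refl:
  assumes "w \<in> lists A" "G \<subseteq> A"
  shows "free_product_cong G w w"
  using assms(1)
proof (induction "length w" arbitrary: w rule: less_induct)
  case less
  show ?case
  proof (cases "w \<in> lists G")
    case True
    then show ?thesis using less.prems by (intro free_product_cong.base cong_refl)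
  next
    case False
    then have "\<exists>x\<in>set w. x \<notin> G" by auto
    \<comment> \<open>The split is made at the last letter outside \<open>G\<close>, so the block
      \<open>g\<close> behind it is a word over \<open>G\<close>.\<close>
    then obtain u t g where w: "w = u @ t # g" "t \<notin> G" "\<forall>y\<in>set g. \<not> y \<notin> G"
      using split_list_last_prop[of w "\<lambda>x. x \<notin> G"] by blast
    then have "g \<in> lists G" "t \<in> A - G" "g \<in> lists A" "u \<in> lists A" using less.prems by auto
    then show ?thesis unfolding w(1) using less.hyps[of u] cong_refl w(1)
      by (intro free_product_cong.snoc) auto
  qed
qed

text \<open>Both sides of a relation are words over \<open>G\<close>, so the step happens inside a
  single block and leaves all separating letters in place.\<close>

lemma free_product_cong_step:
  assumes "free_product_cong G w (x @ l @ y)" "(l, r) \<in> R \<union> R\<inverse>" "R \<subseteq> lists G \<times> lists G"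
  shows "free_product_cong G w (x @ r @ y)"
  using assms(1)
proof (induction w "x @ l @ y" arbitrary: x y)
  case (base g)
  have lr: "l \<in> lists G" "r \<in> lists G" using assms(2,3) by blast+
  have "x \<in> lists A" "y \<in> lists A" using cong_in_lists[OF base(3)] by auto
  then have "(g, x @ r @ y) \<in> cong" using cong_step[OF assms(2)] cong_trans base(3) by blast
  then show ?case using base lr by (intro free_product_cong.base) auto
next
  case (snoc u v t g g')
  have lr: "l \<in> lists G" "r \<in> lists G" using assms(2,3) by blast+
  have t: "t \<notin> G" using snoc by auto
  from snoc(7) have "x @ l @ y = v @ t # g'" by simp
  from lists_subset_splits[OF this lr(1) t]
  consider y' where "v = x @ l @ y'" "y = y' @ t # g'" | x' where "x = v @ t # x'" "g' = x' @ l @ y"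
    by blast
  then show ?case
  proof cases
    case 1
    then have "free_product_cong G (u @ t # g) ((x @ r @ y') @ t # g')"
      using snoc by (intro free_product_cong.snoc) auto
    then show ?thesis using 1 by simp
  next
    case 2
    have "x' \<in> lists A" "y \<in> lists A" using cong_in_lists[OF snoc(6)] 2 by auto
    then have "(g, x' @ r @ y) \<in> cong"
      using cong_step[OF assms(2)] cong_trans snoc(6) 2(2) by blast
    moreover have "x' @ r @ y \<in> lists G" using snoc(5) 2(2) lr by auto
    ultimately have "free_product_cong G (u @ t # g) (v @ t # (x' @ r @ y))"
      using snoc by (intro free_product_cong.snoc) auto
    then show ?thesis using 2 by simp
  qed
qed

text \<open>The normal form splits a congruent pair into pairs of equal letters and congruent pairs
  of blocks over \<open>G\<close>. This presents the congruence as a star, to which the monadic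
  rewriting result can be applied.\<close>

lemma cong_eq_rel_star:
  assumes "R \<subseteq> lists G \<times> lists G" "G \<subseteq> A"
  shows "cong = rel_star ((\<lambda>t. ([t], [t])) ` A \<union> (cong \<inter> lists G \<times> lists G))" (is "_ = rel_star ?D")
proof (intro equalityI subsetI)
  fix p assume "p \<in> rel_star ?D"
  moreover have "(u, v) \<in> cong" if "(u, v) \<in> rel_star ?D" for u v
    using that by (induction rule: rel_star.induct) (auto intro!: cong_append cong_refl)
  ultimately show "p \<in> cong" by (cases p) blast
next
  fix p assume p: "p \<in> cong"
  obtain u v where uv: "p = (u, v)" by fastforce
  have "free_product_cong G u v"
    using p unfolding uv
  proof (induction rule: cong_induct)
    case refl
    show ?case using free_product_cong_refl[OF _ assms(2)] cong_in_lists p uv by blast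
  next
    case (step x y l r)
    then show ?case using free_product_cong_step assms(1) by blast
  qed
  then have "(u, v) \<in> rel_star ?D"
  proof (induction rule: free_product_cong.induct)
    case (base g g')
    then have "([] @ g, [] @ g') \<in> rel_star ?D" by (intro rel_star.snoc rel_star.Nil) auto
    then show ?case by simp
  next
    case (snoc u v t g g')
    then have "((u @ [t]) @ g, (v @ [t]) @ g') \<in> rel_star ?D" by (intro rel_star.snoc) auto
    then show ?case by simp
  qed
  then show "p \<in> rel_star ?D" by (simp add: uv)
qed

end

section \<open>Weakly compressible presentations\<close>

text \<open>If \<open>z\<close> were nonempty, the second \<alpha> would start later than the first.
  Either it lies within \<open>y'\<close>, or it meets the first in a nonempty word \<open>t\<close>
  that is a proper prefix and a proper suffix of \<alpha>.\<close>

lemma self_overlap_free_no_shift: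
  assumes \<alpha>: "self_overlap_free \<alpha>" and y': "\<not> sublist \<alpha> y'" and eq: "z @ \<alpha> @ y = \<alpha> @ y'"
  shows "z = []"
proof -
  consider t where "z = \<alpha> @ t" "t @ \<alpha> @ y = y'" | t where "z @ t = \<alpha>" "\<alpha> @ y = t @ y'"
    using eq unfolding append_eq_append_conv2[of z "\<alpha> @ y" \<alpha> y'] by blast
  then show ?thesis
  proof cases
    case 1
    then have "sublist \<alpha> y'" unfolding sublist_def by metis
    then show ?thesis using y' by blast
  next
    case 2
    show ?thesis
    proof (rule ccontr)
      assume "z \<noteq> []"
      then have len: "length t < length \<alpha>" using 2(1) by auto
      have "prefix t \<alpha>" using 2(2) len prefix_length_prefix[of t "t @ y'" \<alpha>] by (metis less_imp_le prefixI)
      then have "strict_prefix t \<alpha>" using len by (auto simp: strict_prefix_def)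
      moreover have "strict_suffix t \<alpha>" using 2(1) \<open>z \<noteq> []\<close> by (auto simp: strict_suffix_def suffix_def)
      moreover have "t \<noteq> []"
      proof
        assume "t = []"
        then have "sublist \<alpha> y'" using 2(2) unfolding sublist_def by (metis append_Nil)
        then show False using y' by blast
      qed
      moreover have "\<alpha> \<noteq> []" using len by auto
      ultimately show False using \<alpha> unfolding self_overlap_free_def by blast
    qed
  qed
qed

lemma last_occurrence_unique:
  assumes \<alpha>: "self_overlap_free \<alpha>" and y: "\<not> sublist \<alpha> y" "\<not> sublist \<alpha> y'"
    and eq: "x @ \<alpha> @ y = x' @ \<alpha> @ y'"
  shows "x = x' \<and> y = y'"
proof -
  consider z where "x = x' @ z" "z @ \<alpha> @ y = \<alpha> @ y'" | z where "x' = x @ z" "z @ \<alpha> @ y' = \<alpha> @ y"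
    using eq unfolding append_eq_append_conv2[of x "\<alpha> @ y" x' "\<alpha> @ y'"] by (metis (no_types))
  then have "x = x'"
    by cases (use self_overlap_free_no_shift[OF \<alpha>] y in auto)
  then show ?thesis using eq by simp
qed

locale weak_compression = presentation A R for A :: "'a set" and R +
  fixes \<alpha> :: "'a list"
  assumes compressible: "weakly_compressible A R \<alpha>"
begin

lemma \<alpha>: "\<alpha> \<in> lists A" "\<alpha> \<noteq> []" "self_overlap_free \<alpha>"
  using compressible by (simp_all add: weakly_compressible_def)

text \<open>These words play two roles: as the part of a word before its first \<alpha>, and as what
  follows \<alpha> in an element of \<open>\<Sigma>\<^sub>*\<close> (\<open>S_eq\<close>).\<close>

definition F :: "'a list set" where "F = {p \<in> lists A. \<not> sublist \<alpha> p}"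

abbreviation "S \<equiv> Sigma_star A \<alpha>"
abbreviation "LR \<equiv> left_relations A R \<alpha>"
abbreviation "G \<equiv> left_generators A R \<alpha>"

lemma F_lists: "p \<in> F \<Longrightarrow> p \<in> lists A"
  by (simp add: F_def)

lemma S_eq: "S = (@) \<alpha> ` F"
  unfolding Sigma_star_def F_def by blast

lemma S_lists: "s \<in> S \<Longrightarrow> s \<in> lists A"
  using \<alpha>(1) by (auto simp: S_eq F_def)

lemma concat_lists: "\<sigma> \<in> lists S \<Longrightarrow> concat \<sigma> \<in> lists A"
  using S_lists by (induction \<sigma>) auto

lemma Nil_in_F: "[] \<in> F" using \<alpha>(2) by (simp add: F_def)

lemma \<alpha>_in_S: "\<alpha> \<in> S"
  unfolding S_eq using Nil_in_F by (metis append_Nil2 imageI)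

text \<open>A letter put in front either leaves the initial part free of \<alpha>, or completes an
  occurrence of \<alpha> at the very beginning. In the latter case the whole initial part becomes a
  new first factor.\<close>

lemma factorization_ex:
  assumes "w \<in> lists A"
  shows "\<exists>p\<in>F. \<exists>\<sigma>\<in>lists S. w = p @ concat \<sigma>"
  using assms
proof (induction w)
  case Nil
  then show ?case using Nil_in_F by (intro bexI[of _ "[]"]) auto
next
  case (Cons a w)
  then obtain p \<sigma> where *: "p \<in> F" "\<sigma> \<in> lists S" "w = p @ concat \<sigma>" by auto
  show ?case
  proof (cases "sublist \<alpha> (a # p)")
    case False
    have "a # p \<in> F" using False Cons.hyps(1) *(1) by (simp add: F_def)
    then show ?thesis using * by (intro bexI[of _ "a # p"] bexI[of _ \<sigma>]) auto
  next
    case True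
    then have "prefix \<alpha> (a # p)" using *(1) by (simp add: F_def sublist_Cons_right)
    then obtain y where y: "a # p = \<alpha> @ y" by (auto simp: prefix_def)
    then have "suffix y p" using \<alpha>(2) by (cases \<alpha>) (auto simp: suffix_def)
    then have "y \<in> F" using *(1) by (auto simp: F_def suffix_def sublist_append)
    then have "(\<alpha> @ y) # \<sigma> \<in> lists S" using *(2) by (auto simp: S_eq)
    moreover have "a # w = [] @ concat ((\<alpha> @ y) # \<sigma>)" using *(3) y by simp
    ultimately show ?thesis using Nil_in_F by blast
  qed
qed

text \<open>The last factor starts at the last occurrence of \<alpha>, which is unique, so the
  factors can be compared one by one from the right.\<close>

lemma factorization_unique:
  assumes "p \<in> F" "p' \<in> F" "\<sigma> \<in> lists S" "\<sigma>' \<in> lists S" "p @ concat \<sigma> = p' @ concat \<sigma>'"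
  shows "p = p' \<and> \<sigma> = \<sigma>'"
proof -
  have no: "p @ concat \<sigma> \<noteq> q" if "\<sigma> \<in> lists S" "\<sigma> \<noteq> []" "q \<in> F" for p \<sigma> q
  proof -
    obtain \<sigma>0 s where s: "\<sigma> = \<sigma>0 @ [s]" using \<open>\<sigma> \<noteq> []\<close> by (metis rev_exhaust)
    then obtain y where "s = \<alpha> @ y" using \<open>\<sigma> \<in> lists S\<close> by (auto simp: S_eq)
    then have "p @ concat \<sigma> = (p @ concat \<sigma>0) @ \<alpha> @ y" by (simp add: s)
    then have "sublist \<alpha> (p @ concat \<sigma>)" unfolding sublist_def by blast
    then show ?thesis using that(3) by (auto simp: F_def)
  qed
  show ?thesis
    using assms(3-5)
  proof (induction \<sigma> arbitrary: \<sigma>' rule: rev_induct)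
    case Nil
    then show ?case using no[of \<sigma>' p p'] assms(1) by (cases "\<sigma>' = []") auto
  next
    case (snoc s \<sigma>)
    then have "\<sigma>' \<noteq> []" using no[of "\<sigma> @ [s]" p' p] no[of "\<sigma> @ [s]" p p'] assms(2) by fastforce
    then obtain \<sigma>0 s' where s': "\<sigma>' = \<sigma>0 @ [s']" by (metis rev_exhaust)
    have "s \<in> S" "s' \<in> S" using snoc.prems s' by auto
    then obtain y y' where y: "s = \<alpha> @ y" "s' = \<alpha> @ y'" "\<not> sublist \<alpha> y" "\<not> sublist \<alpha> y'"
      by (auto simp: S_eq F_def)
    have "(p @ concat \<sigma>) @ \<alpha> @ y = (p' @ concat \<sigma>0) @ \<alpha> @ y'"
      using snoc.prems(3) by (simp add: s' y)
    then have "p @ concat \<sigma> = p' @ concat \<sigma>0 \<and> y = y'"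
      using last_occurrence_unique[OF \<alpha>(3) y(3,4)] by blast
    then show ?case using snoc.IH[of \<sigma>0] snoc.prems(1,2) s' y by auto
  qed
qed

lemma concat_S_inj: "\<sigma> \<in> lists S \<Longrightarrow> \<sigma>' \<in> lists S \<Longrightarrow> concat \<sigma> = concat \<sigma>' \<Longrightarrow> \<sigma> = \<sigma>'"
  using factorization_unique[OF Nil_in_F Nil_in_F] by simp

text \<open>Sealing is what makes the description by \<open>THE\<close> meaningful: \<alpha> at the
  end of \<open>u\<close> can be split off, and \<alpha> at the beginning leaves nothing in front of
  the first factor.\<close>

lemma left_word:
  assumes "(u, v) \<in> R \<union> R\<inverse>"
  shows "left_word A \<alpha> u \<in> lists S" "concat (left_word A \<alpha> u) @ \<alpha> = u"
proof -
  have "sealed A \<alpha> (u, v) \<or> sealed A \<alpha> (v, u)"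
    using assms compressible by (auto simp: weakly_compressible_def)
  then have "u \<in> {\<alpha> @ x | x. x \<in> lists A}" "u \<in> {x @ \<alpha> | x. x \<in> lists A}"
    unfolding sealed_def by blast+
  then obtain x x' where x: "u = \<alpha> @ x" "u = x' @ \<alpha>" "x \<in> lists A" "x' \<in> lists A" by blast
  obtain p \<sigma> where p: "p \<in> F" "\<sigma> \<in> lists S" "x' = p @ concat \<sigma>"
    using factorization_ex[OF x(4)] by blast
  obtain q \<rho> where q: "q \<in> F" "\<rho> \<in> lists S" "x = q @ concat \<rho>"
    using factorization_ex[OF x(3)] by blast
  \<comment> \<open>Two factorisations of \<open>u\<close>, one from its ending in \<alpha> and one
    from its beginning with \<alpha>; comparing them forces \<open>p\<close> to be empty.\<close>
  have "p @ concat (\<sigma> @ [\<alpha>]) = [] @ concat ((\<alpha> @ q) # \<rho>)"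
    using x p(3) q(3) by simp
  moreover have "\<sigma> @ [\<alpha>] \<in> lists S" "(\<alpha> @ q) # \<rho> \<in> lists S"
    using p(2) q \<alpha>_in_S by (auto simp: S_eq)
  ultimately have "p = []" using factorization_unique[OF p(1) Nil_in_F] by blast
  then have ex: "\<sigma> \<in> lists S \<and> u = concat \<sigma> @ \<alpha>" using p x(2) by simp
  have "\<rho> = \<sigma>" if "\<rho> \<in> lists S \<and> u = concat \<rho> @ \<alpha>" for \<rho>
    using that ex concat_S_inj by simp
  with ex have "left_word A \<alpha> u \<in> lists S \<and> u = concat (left_word A \<alpha> u) @ \<alpha>"
    unfolding left_word_def by (rule theI)
  then show "left_word A \<alpha> u \<in> lists S" "concat (left_word A \<alpha> u) @ \<alpha> = u" by simp_all
qed

lemma left_relationsE: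
  assumes "(l, r) \<in> LR \<union> LR\<inverse>"
  shows "(concat l @ \<alpha>, concat r @ \<alpha>) \<in> R \<union> R\<inverse>"
proof -
  obtain u v where "(u, v) \<in> R \<union> R\<inverse>" "l = left_word A \<alpha> u" "r = left_word A \<alpha> v"
    using assms by (auto simp: left_relations_def)
  moreover from this have "(v, u) \<in> R \<union> R\<inverse>" by blast
  ultimately show ?thesis using left_word(2) by metis
qed

lemma left_relationsI:
  assumes "(u, v) \<in> R \<union> R\<inverse>"
  shows "(left_word A \<alpha> u, left_word A \<alpha> v) \<in> LR \<union> LR\<inverse>"
  using assms by (force simp: left_relations_def)

lemma G_subset_S: "G \<subseteq> S"
  using left_word(1) by (auto simp: left_generators_def)

lemma LR_in_lists_G: "LR \<subseteq> lists G \<times> lists G"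
  by (auto simp: left_relations_def left_generators_def)

lemma LR_in_lists_S: "LR \<subseteq> lists S \<times> lists S"
  using LR_in_lists_G lists_mono[OF G_subset_S] by blast

sublocale left: presentation S LR
  by unfold_locales (rule LR_in_lists_S)

text \<open>
  Occurrences of \<open>\<alpha>\<close> do not overlap, so an application of a relation changes neither the part of a
  word before the first occurrence of \<open>\<alpha>\<close> nor its last factor in \<open>\<Sigma>\<^sub>*\<close>.
\<close>

lemma cong_iff_left_cong:
  "(w, w') \<in> cong \<longleftrightarrow> (w = w' \<and> w \<in> F) \<or>
     (\<exists>p \<sigma> \<sigma>' t. p \<in> F \<and> (\<sigma>, \<sigma>') \<in> left.cong \<and> t \<in> S \<and> w = p @ concat \<sigma> @ t \<and> w' = p @ concat \<sigma>' @ t)"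
  (is "_ \<longleftrightarrow> ?Q w w'")
proof
  assume "(w, w') \<in> cong"
  then show "?Q w w'"
  proof (induction rule: cong_induct)
    case refl
    have "w \<in> lists A" using \<open>(w, w') \<in> cong\<close> cong_in_lists by blast
    then obtain p \<sigma> where p: "p \<in> F" "\<sigma> \<in> lists S" "w = p @ concat \<sigma>" using factorization_ex by blast
    show ?case
    proof (cases \<sigma> rule: rev_cases)
      case Nil
      then show ?thesis using p by simp
    next
      case (snoc \<sigma>0 t)
      then have "(\<sigma>0, \<sigma>0) \<in> left.cong" "t \<in> S" "w = p @ concat \<sigma>0 @ t"
        using p(2,3) left.cong_refl by auto
      then show ?thesis using p(1) by blast
    qed
  next
    case (step x y l r)
    define us where "us = left_word A \<alpha> l"
    define vs where "vs = left_word A \<alpha> r"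
    have us: "us \<in> lists S" "l = concat us @ \<alpha>" using left_word[OF step(5)] by (simp_all add: us_def)
    have "(r, l) \<in> R \<union> R\<inverse>" using step(5) by blast
    then have vs: "vs \<in> lists S" "r = concat vs @ \<alpha>" using left_word by (simp_all add: vs_def)
    have usvs: "(us, vs) \<in> LR \<union> LR\<inverse>" using left_relationsI[OF step(5)] by (simp add: us_def vs_def)
    obtain p xs where x: "p \<in> F" "xs \<in> lists S" "x = p @ concat xs" using factorization_ex[OF step(3)] by blast
    obtain q ys where y: "q \<in> F" "ys \<in> lists S" "y = q @ concat ys" using factorization_ex[OF step(4)] by blast
    have "(\<alpha> @ q) # ys \<in> lists S" using y by (auto simp: S_eq)
    \<comment> \<open>The final \<alpha> of \<open>l\<close> or \<open>r\<close> joins the initial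
      part \<open>q\<close> of \<open>y\<close> to form a factor. Hence there is always a last
      factor \<open>t\<close> behind the rewritten part, and the step does not touch it.\<close>
    obtain zs t where z: "(\<alpha> @ q) # ys = zs @ [t]" by (metis list.distinct(1) rev_exhaust)
    have zS: "zs \<in> lists S" "t \<in> S" using \<open>(\<alpha> @ q) # ys \<in> lists S\<close> unfolding z by auto
    have cz: "\<alpha> @ y = concat zs @ t" using arg_cong[OF z, of concat] y(3) by simp
    have xl: "x @ l @ y = p @ concat (xs @ us @ zs) @ t" using x us cz by simp
    have xr: "x @ r @ y = p @ concat (xs @ vs @ zs) @ t" using x vs cz by simp
    have lc: "(xs @ us @ zs, xs @ vs @ zs) \<in> left.cong" using left.cong_step[OF usvs x(2) zS(1)] .
    have S1: "xs @ us @ zs \<in> lists S" using left.cong_in_lists[OF lc] by blast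
    from step(1) show ?case
    proof (elim disjE exE conjE)
      assume "w = x @ l @ y" "w \<in> F"
      then show ?thesis using lc x(1) zS(2) xl xr by blast
    next
      fix p' \<sigma> \<sigma>' t'
      assume *: "p' \<in> F" "(\<sigma>, \<sigma>') \<in> left.cong" "t' \<in> S" "w = p' @ concat \<sigma> @ t'"
        "x @ l @ y = p' @ concat \<sigma>' @ t'"
      have "\<sigma>' \<in> lists S" using left.cong_in_lists[OF *(2)] by blast
      moreover have "p' @ concat (\<sigma>' @ [t']) = p @ concat ((xs @ us @ zs) @ [t])"
        using *(5) xl by simp
      ultimately have "p' = p \<and> \<sigma>' @ [t'] = (xs @ us @ zs) @ [t]"
        using factorization_unique[OF *(1) x(1), of "\<sigma>' @ [t']" "(xs @ us @ zs) @ [t]"] *(3) zS S1 by auto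
      then have "p' = p" "\<sigma>' = xs @ us @ zs" "t' = t" by simp_all
      then have "(\<sigma>, xs @ vs @ zs) \<in> left.cong" using left.cong_trans[OF *(2)] lc by blast
      then show ?thesis using x(1) zS(2) xr *(4) \<open>p' = p\<close> \<open>t' = t\<close> by blast
    qed
  qed
next
  have left: "(concat \<sigma> @ t, concat \<sigma>' @ t) \<in> cong" if "(\<sigma>, \<sigma>') \<in> left.cong" and t: "t \<in> S" for \<sigma> \<sigma>' t
    using that(1)
  proof (induction rule: left.cong_induct)
    case refl
    then show ?case
      using that t left.cong_in_lists concat_lists S_lists by (intro cong_refl) auto
  next
    case (step x y l r)
    \<comment> \<open>A relation of \<open>M\<close> ends in an \<alpha> that its counterpart in
      \<open>LR\<close> lacks. This \<alpha> is borrowed from the factor that follows; appending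
      \<open>t\<close> ensures that there is one.\<close>
    obtain q ys where z: "y @ [t] = (\<alpha> @ q) # ys" "q \<in> lists A" "ys \<in> lists S"
    proof -
      obtain s ys where s: "y @ [t] = s # ys" by (cases "y @ [t]") auto
      have "s # ys \<in> lists S" unfolding s[symmetric] using step(4) t by simp
      then have "s \<in> S" "ys \<in> lists S" by simp_all
      then obtain q where "s = \<alpha> @ q" "q \<in> lists A" by (auto simp: S_eq F_def)
      then show thesis using that s \<open>ys \<in> lists S\<close> by simp
    qed
    have cz: "concat y @ t = \<alpha> @ q @ concat ys" using arg_cong[OF z(1), of concat] by simp
    have "(concat x @ (concat l @ \<alpha>) @ (q @ concat ys), concat x @ (concat r @ \<alpha>) @ (q @ concat ys)) \<in> cong"
      using left_relationsE[OF step(5)] concat_lists step(3) z(2,3) by (intro cong_step) auto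
    then have "(concat (x @ l @ y) @ t, concat (x @ r @ y) @ t) \<in> cong" using cz by simp
    then show ?case using step(1) cong_trans by blast
  qed
  assume "?Q w w'"
  then show "(w, w') \<in> cong"
  proof (elim disjE exE conjE)
    assume "w = w'" "w \<in> F"
    then show ?thesis using cong_refl F_lists by blast
  next
    fix p \<sigma> \<sigma>' t
    assume *: "p \<in> F" "(\<sigma>, \<sigma>') \<in> left.cong" "t \<in> S" "w = p @ concat \<sigma> @ t" "w' = p @ concat \<sigma>' @ t"
    then show ?thesis
      using cong_append[OF cong_refl[OF F_lists[OF *(1)]] left[OF *(2,3)]] by simp
  qed
qed

text \<open>As \<alpha> itself lies in \<open>\<Sigma>\<^sub>*\<close>, this is the case of an empty
  initial part and last factor \<alpha>; unique factorisation identifies these parts in the converse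
  direction.\<close>

lemma left_cong_iff_cong:
  assumes "\<sigma> \<in> lists S" "\<sigma>' \<in> lists S"
  shows "(\<sigma>, \<sigma>') \<in> left.cong \<longleftrightarrow> (concat \<sigma> @ \<alpha>, concat \<sigma>' @ \<alpha>) \<in> cong"
proof
  assume "(\<sigma>, \<sigma>') \<in> left.cong"
  then show "(concat \<sigma> @ \<alpha>, concat \<sigma>' @ \<alpha>) \<in> cong"
    unfolding cong_iff_left_cong using Nil_in_F \<alpha>_in_S by (metis append_Nil)
next
  assume "(concat \<sigma> @ \<alpha>, concat \<sigma>' @ \<alpha>) \<in> cong"
  then consider "concat \<sigma> @ \<alpha> \<in> F"
    | p \<rho> \<rho>' t where "p \<in> F" "(\<rho>, \<rho>') \<in> left.cong" "t \<in> S"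
      "concat \<sigma> @ \<alpha> = p @ concat \<rho> @ t" "concat \<sigma>' @ \<alpha> = p @ concat \<rho>' @ t"
    unfolding cong_iff_left_cong by blast
  then show "(\<sigma>, \<sigma>') \<in> left.cong"
  proof cases
    case 1
    then show ?thesis unfolding F_def by (metis (no_types, lifting) append_Nil2 mem_Collect_eq sublist_appendI)
  next
    case 2
    have S: "\<rho> \<in> lists S" "\<rho>' \<in> lists S" using left.cong_in_lists[OF 2(2)] by auto
    have "[] = p \<and> \<sigma> @ [\<alpha>] = \<rho> @ [t]"
      by (rule factorization_unique) (use 2 S assms Nil_in_F \<alpha>_in_S in auto)
    moreover have "[] = p \<and> \<sigma>' @ [\<alpha>] = \<rho>' @ [t]"
      by (rule factorization_unique) (use 2 S assms Nil_in_F \<alpha>_in_S in auto)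
    ultimately show ?thesis using 2(2) by simp
  qed
qed

lemma finite_G: "finite R \<Longrightarrow> finite G"
  unfolding left_generators_def by (rule finite_UN_I) auto

lemma generates_left_monoid: "generates_via (left_monoid A R \<alpha>) G left.cls"
  unfolding left_monoid_def extended_left_monoid_def
  using generates_submonoid_generated[OF left.generates_presented_monoid G_subset_S] .

text \<open>\<open>\<Sigma>\<^sub>*\<close> is infinite in general and cannot serve as the alphabet
  of a language. Applying \<open>concat\<close> to the free product description turns its letters
  into words over \<open>A\<close>, and the pairs of equal letters into the diagonal of
  \<open>S\<close>.\<close>

lemma cong_eq_rel_append_star:
  "cong = Id_on F \<union> rel_append (Id_on F)
     (rel_append (rel_star (Id_on S \<union> (\<lambda>(u, v). (concat u, concat v)) ` (left.cong \<inter> lists G \<times> lists G))) (Id_on S))"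
    (is "_ = Id_on F \<union> rel_append (Id_on F) (rel_append (rel_star ?D) (Id_on S))")
proof -
  let ?E = "(\<lambda>t. ([t], [t])) ` S \<union> (left.cong \<inter> lists G \<times> lists G)"
  let ?f = "\<lambda>(u, v). (concat u, concat v)"
  have D: "?D = ?f ` ?E" by (auto simp: image_Un image_image Id_on_def)
  have "rel_star ?D = ?f ` rel_star ?E"
    unfolding D by (rule rel_star_concat)
  also have "\<dots> = ?f ` left.cong"
    using left.cong_eq_rel_star[OF LR_in_lists_G G_subset_S] by (rule arg_cong[OF sym])
  finally have mem: "(u, v) \<in> rel_star ?D \<longleftrightarrow> (\<exists>\<sigma> \<sigma>'. (\<sigma>, \<sigma>') \<in> left.cong \<and> u = concat \<sigma> \<and> v = concat \<sigma>')" for u v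
    by auto
  have "(w, w') \<in> rel_append (Id_on F) (rel_append (rel_star ?D) (Id_on S)) \<longleftrightarrow>
      (\<exists>p \<sigma> \<sigma>' t. p \<in> F \<and> (\<sigma>, \<sigma>') \<in> left.cong \<and> t \<in> S \<and> w = p @ concat \<sigma> @ t \<and> w' = p @ concat \<sigma>' @ t)" for w w'
    unfolding rel_append_def mem_Collect_eq Id_on_iff prod.inject mem by fastforce
  then have "(w, w') \<in> cong \<longleftrightarrow>
      (w, w') \<in> Id_on F \<union> rel_append (Id_on F) (rel_append (rel_star ?D) (Id_on S))" for w w'
    unfolding cong_iff_left_cong Un_iff Id_on_iff by presburger
  then show ?thesis by (intro equalityI subrelI) blast+
qed

section \<open>Transfer of the word problem between \<open>M\<close> and \<open>L(M)\<close>\<close>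

context
  fixes C
  assumes C: "super_afl C" and A: "finite A" and R: "finite R"
begin

interpretation super_afl C by (rule C)

lemma rel_in_Id_on_F: "rel_in C (Id_on F)"
proof -
  have "{(u, v). (u, v) \<in> Id_on (lists A) \<and> \<not> sublist \<alpha> u} = Id_on F"
    by (auto simp: F_def)
  then show ?thesis using rel_in_avoiding[OF rel_in_Id_on_lists[OF A] \<alpha>(2)] by simp
qed

lemma rel_in_Id_on_S: "rel_in C (Id_on S)"
proof -
  have "(\<lambda>(u, v). (\<alpha> @ u, \<alpha> @ v)) ` Id_on F = Id_on S" by (force simp: S_eq)
  then show ?thesis using rel_in_append_left[OF rel_in_Id_on_F, of \<alpha> \<alpha>] by simp
qed

lemma has_word_problem_iff:
  "has_word_problem_in (presented_monoid A R) C \<longleftrightarrow> has_word_problem_in (left_monoid A R \<alpha>) C"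
proof -
  have M: "has_word_problem_in (presented_monoid A R) C \<longleftrightarrow> rel_in C cong"
  proof -
    have "word_problem_rel A cls = cong"
      using word_problem_rel_cls[of A] by (simp add: pres_cong_def Int_assoc)
    then show ?thesis using has_word_problem_in_iff_rel_in[OF generates_presented_monoid A] by simp
  qed
  let ?K = "left.cong \<inter> lists G \<times> lists G"
  have L: "has_word_problem_in (left_monoid A R \<alpha>) C \<longleftrightarrow> rel_in C ?K"
    using has_word_problem_in_iff_rel_in[OF generates_left_monoid finite_G[OF R]]
      left.word_problem_rel_cls[OF G_subset_S] by simp
  \<comment> \<open>A symbol of \<open>G\<close> is the very word over \<open>A\<close> that it
    stands for, so the identity on letters extends to the inverse of the isomorphism
    \<open>\<phi>\<close>.\<close>
  have id: "hom_ext (\<lambda>x. x) u = concat u" for u :: "'a list list" by (simp add: hom_ext_def)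
  show ?thesis
    unfolding M L
  proof
    assume "rel_in C cong"
    then have "rel_in C {(u, v). u \<in> lists G \<and> v \<in> lists G \<and> (hom_ext (\<lambda>x. x) u @ \<alpha>, hom_ext (\<lambda>x. x) v @ \<alpha>) \<in> cong}"
      using finite_G[OF R] by (rule rel_in_inverse_image)
    moreover have "{(u, v). u \<in> lists G \<and> v \<in> lists G \<and> (concat u @ \<alpha>, concat v @ \<alpha>) \<in> cong} = ?K"
      using left_cong_iff_cong lists_mono[OF G_subset_S] by blast
    ultimately show "rel_in C ?K" by (simp add: id)
  next
    assume "rel_in C ?K"
    then have "rel_in C ((\<lambda>(u, v). (concat u, concat v)) ` ?K)"
      using rel_in_hom[of ?K "\<lambda>x. x"] by (simp add: id)
    then show "rel_in C cong"
      unfolding cong_eq_rel_append_star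
      by (intro rel_in_Un rel_in_append_star_append rel_in_Id_on_F rel_in_Id_on_S)
  qed
qed

end

end

theorem theorem1p1:
  fixes C :: "nat list set set"
    and A :: "'a set"
    and R :: "('a list \<times> 'a list) set"
    and \<alpha> :: "'a list"
  assumes "super_AFL C"
    and "reversal_closed C"
    and "finite A"
    and "finite R"
    and "R \<subseteq> lists A \<times> lists A"
    and "weakly_compressible A R \<alpha>"
  shows "has_word_problem_in (presented_monoid A R) C \<longleftrightarrow>
         has_word_problem_in (left_monoid A R \<alpha>) C"
proof (cases "C = {}")
  \<comment> \<open>The closure conditions also hold for the empty class, in which no monoid has its
    word problem.\<close>
  case True
  then show ?thesis by (simp add: has_word_problem_in_def)
next
  case False
  interpret weak_compression A R \<alpha>
    using assms(5,6) by unfold_locales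
  have "super_afl C"
    using assms(1) False unfolding super_AFL_def by unfold_locales auto
  then show ?thesis using assms(3,4) by (rule has_word_problem_iff)
qed

end
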